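(* Let $n\ge 2$, $\mu\in\mathbb R$ with $\mu\neq 0$, and $B\in\mathfrak u(n)$. Let $\mathfrak g=\mathbb R f_1\ltimes\mathbb R^{2n+1}$ be the Lie algebra in which $\mathbb R^{2n+1}=\mathbb Rf_2\oplus\mathbb R^{2n}$ is an abelian ideal and $\operatorname{ad}_{f_1}|_{\mathbb R^{2n+1}}$ has block-diagonal matrix $\operatorname{diag}\big(\mu,\ -\tfrac{\mu}{2n}I_{2n}+B\big)$ with respect to the decomposition $\mathbb Rf_2\oplus\mathbb R^{2n}$. Then the simply connected Lie group $G$ with Lie algebra $\mathfrak g$ admits no lattice.
   Context: $\mathfrak u(n)$ denotes the set of real $2n\times 2n$ matrices $B$ with $B^{T}=-B$ and $BJ_0=J_0B$, where $J_0=\begin{pmatrix}0&-I_n\\ I_n&0\end{pmatrix}$. A lattice in $G$ is a discrete subgroup $\Gamma$ such that $\Gamma\backslash G$ is compact. (These Lie algebras are exactly the non-nilpotent unimodular almost abelian Lie algebras of dimension $2n+2$ carrying an LCK structure.) *)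

theory Defs
  imports "HOL-Analysis.Analysis"
begin

text \<open>Index set of R^(2n+1) = R f2 (+) R^(2n): Inl () is f2, Inr (Inl i) / Inr (Inr i)
  are the first / second block of R^(2n) (so J0 has the block form [[0,-I],[I,0]]).\<close>

definition J0 :: "real^('n::finite + 'n)^('n + 'n)" where
  "J0 = (\<chi> i j. case (i, j) of
            (Inl a, Inr b) \<Rightarrow> (if a = b then -1 else 0)
          | (Inr a, Inl b) \<Rightarrow> (if a = b then 1 else 0)
          | _ \<Rightarrow> 0)"

definition in_u :: "real^('n::finite + 'n)^('n + 'n) \<Rightarrow> bool" where
  "in_u B \<longleftrightarrow> transpose B = - B \<and> B ** J0 = J0 ** B"

definition adf1 :: "real \<Rightarrow> real^('n::finite + 'n)^('n + 'n)
     \<Rightarrow> real^(unit + ('n + 'n))^(unit + ('n + 'n))" where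
  "adf1 \<mu> B = (\<chi> i j. case (i, j) of
            (Inl _, Inl _) \<Rightarrow> \<mu>
          | (Inr a, Inr b) \<Rightarrow> (if a = b then - (\<mu> / (2 * real CARD('n))) else 0) + B $ a $ b
          | _ \<Rightarrow> 0)"

fun mpow :: "real^'m^'m \<Rightarrow> nat \<Rightarrow> real^'m^'m" where
  "mpow A 0 = mat 1"
| "mpow A (Suc k) = A ** mpow A k"

definition mexp :: "real^'m^'m \<Rightarrow> real^'m^'m" where
  "mexp A = (\<Sum>k. (1 / fact k) *\<^sub>R mpow A k)"

text \<open>The simply connected Lie group G = R \<ltimes> R^(2n+1) with Lie algebra R f1 \<ltimes>_A R^(2n+1),
  realised on R x R^(2n+1) with product (t,v)(s,w) = (t+s, v + exp(tA) w)
  and its Euclidean topology.\<close>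
definition gmul :: "real^'m^'m \<Rightarrow> real \<times> (real^'m) \<Rightarrow> real \<times> (real^'m) \<Rightarrow> real \<times> (real^'m)" where
  "gmul A x y = (fst x + fst y, snd x + mexp (fst x *\<^sub>R A) *v snd y)"

definition ginv :: "real^'m^'m \<Rightarrow> real \<times> (real^'m) \<Rightarrow> real \<times> (real^'m)" where
  "ginv A x = (- fst x, - (mexp ((- fst x) *\<^sub>R A) *v snd x))"

definition is_subgroup :: "real^'m^'m \<Rightarrow> (real \<times> (real^'m)) set \<Rightarrow> bool" where
  "is_subgroup A \<Gamma> \<longleftrightarrow> (0, 0) \<in> \<Gamma> \<and>
      (\<forall>x\<in>\<Gamma>. \<forall>y\<in>\<Gamma>. gmul A x y \<in> \<Gamma>) \<and> (\<forall>x\<in>\<Gamma>. ginv A x \<in> \<Gamma>)"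

definition discrete_set :: "('a::metric_space) set \<Rightarrow> bool" where
  "discrete_set S \<longleftrightarrow> (\<forall>x\<in>S. \<exists>e>0. \<forall>y\<in>S. dist y x < e \<longrightarrow> y = x)"

definition rcoset :: "real^'m^'m \<Rightarrow> (real \<times> (real^'m)) set \<Rightarrow> real \<times> (real^'m)
     \<Rightarrow> (real \<times> (real^'m)) set" where
  "rcoset A \<Gamma> g = (\<lambda>\<gamma>. gmul A \<gamma> g) ` \<Gamma>"

definition quot_top :: "real^'m^'m \<Rightarrow> (real \<times> (real^'m)) set
     \<Rightarrow> (real \<times> (real^'m)) set topology" where
  "quot_top A \<Gamma> = topology (\<lambda>U. U \<subseteq> range (rcoset A \<Gamma>) \<and> open (\<Union>U))"

definition is_lattice :: "real^'m^'m \<Rightarrow> (real \<times> (real^'m)) set \<Rightarrow> bool" where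
  "is_lattice A \<Gamma> \<longleftrightarrow> is_subgroup A \<Gamma> \<and> discrete_set \<Gamma> \<and> compact_space (quot_top A \<Gamma>)"

end

theory Submission
  imports Defs "HOL-Computational_Algebra.Fundamental_Theorem_Algebra"
begin

text \<open>
  If \<open>\<Gamma>\<close> is a lattice in \<open>G\<close>, pick \<open>(t, v) \<in> \<Gamma>\<close> with \<open>t \<noteq> 0\<close> and put \<open>T = exp (t A)\<close>.  Commutators with
  \<open>(t, v)\<close> show that \<open>\<Gamma>\<close> meets the abelian ideal in a lattice, which \<open>T\<close> preserves.  Hence the
  characteristic polynomial \<open>f\<close> of \<open>T\<close> has integer coefficients.  Its roots are \<open>\<lambda> = exp (t \<mu>)\<close>
  and \<open>2n\<close> numbers of modulus \<open>\<surd>D\<close>, where \<open>D = exp (- t \<mu> / n)\<close>, so that \<open>\<lambda> D^n = 1\<close>.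

  Since \<open>T\<close> is \<open>\<surd>D\<close> times an orthogonal matrix on \<open>R^(2n)\<close>, all roots but \<open>\<lambda>\<close> are permuted by
  \<open>z \<mapsto> D / z\<close>, which gives \<open>(x - \<lambda>) x^(2n+1) f (D / x) = (D / \<lambda> - x) f x\<close>.  The coefficients
  of \<open>x\<close> and \<open>x^2\<close> are two integer polynomial relations for \<open>D\<close>, the second one of degree at
  most \<open>2n\<close>.  But the conjugates \<open>z\<close> of the unit \<open>D\<close> satisfy \<open>f (z^(-n)) = 0\<close>, hence have modulus
  \<open>D\<close> or \<open>D^(-1/(2n))\<close>; as their product is \<open>\<plusminus>1\<close>, the degree of \<open>D\<close> is at least \<open>2n + 1\<close>.  So the
  second relation is trivial, and for \<open>n \<ge> 2\<close> the first one then reads \<open>D^(2n+1) = 1\<close>.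
\<close>

section \<open>The matrix exponential\<close>

text \<open>Supplies a geometric majorant for the exponential series. The constant is the sum of all
  absolute entries, which dominates every row sum.\<close>

lemma mpow_entry_bound:
  fixes A :: "real^'m^'m"
  shows "\<bar>mpow A k $ i $ j\<bar> \<le> (\<Sum>a\<in>UNIV. \<Sum>b\<in>UNIV. \<bar>A $ a $ b\<bar>) ^ k"
proof (induction k arbitrary: i)
  case 0
  show ?case by (simp add: mat_def)
next
  case (Suc k)
  let ?c = "\<Sum>a\<in>UNIV. \<Sum>b\<in>UNIV. \<bar>A $ a $ b\<bar>"
  have c0: "0 \<le> ?c" by (intro sum_nonneg) auto
  have "\<bar>mpow A (Suc k) $ i $ j\<bar> \<le> (\<Sum>l\<in>UNIV. \<bar>A $ i $ l * mpow A k $ l $ j\<bar>)"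
    by (simp add: matrix_matrix_mult_def sum_abs)
  also have "\<dots> \<le> (\<Sum>l\<in>UNIV. \<bar>A $ i $ l\<bar> * ?c ^ k)"
    by (intro sum_mono) (simp add: abs_mult Suc mult_left_mono)
  also have "\<dots> = (\<Sum>l\<in>UNIV. \<bar>A $ i $ l\<bar>) * ?c ^ k"
    by (simp add: sum_distrib_right)
  also have "\<dots> \<le> ?c * ?c ^ k"
  proof (intro mult_right_mono)
    show "(\<Sum>l\<in>UNIV. \<bar>A $ i $ l\<bar>) \<le> ?c"
      by (rule member_le_sum[where f="\<lambda>a. \<Sum>b\<in>UNIV. \<bar>A $ a $ b\<bar>"]) (auto intro: sum_nonneg)
  qed (use c0 in auto)
  finally show ?case by simp
qed

lemma summable_mexp_entry:
  fixes A :: "real^'m^'m"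
  shows "summable (\<lambda>k. norm (((1 / fact k) *\<^sub>R mpow A k) $ i $ j))"
proof (rule summable_comparison_test')
  let ?c = "\<Sum>a\<in>UNIV. \<Sum>b\<in>UNIV. \<bar>A $ a $ b\<bar>"
  show "summable (\<lambda>k. inverse (fact k) * ?c ^ k)"
    by (rule summable_exp)
  show "norm (norm (((1 / fact k) *\<^sub>R mpow A k) $ i $ j)) \<le> inverse (fact k) * ?c ^ k"
    if "0 \<le> k" for k
    using mpow_entry_bound[of A k i j] by (simp add: abs_mult divide_inverse mult_left_mono)
qed

text \<open>Convergence of matrices is entrywise, so the scalar comparison with the real exponential
  series suffices. This gives the \<open>suminf\<close> in \<open>mexp\<close> its meaning.\<close>

lemma mexp_sums:
  fixes A :: "real^'m^'m"
  shows "(\<lambda>k. (1 / fact k) *\<^sub>R mpow A k) sums mexp A"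
proof -
  let ?f = "\<lambda>k. (1 / fact k) *\<^sub>R mpow A k"
  have "?f sums (\<chi> i j. \<Sum>k. ?f k $ i $ j)"
    unfolding sums_def
  proof (intro vec_tendstoI)
    fix i j
    have "(\<lambda>k. ?f k $ i $ j) sums (\<Sum>k. ?f k $ i $ j)"
      using summable_norm_cancel[OF summable_mexp_entry] by (rule summable_sums)
    then show "(\<lambda>n. (\<Sum>k<n. ?f k) $ i $ j) \<longlonglongrightarrow> (\<chi> i j. \<Sum>k. ?f k $ i $ j) $ i $ j"
      by (simp add: sums_def)
  qed
  then show ?thesis
    unfolding mexp_def by (simp add: sums_iff)
qed

lemma mexp_entry_sums:
  fixes A :: "real^'m^'m"
  shows "(\<lambda>k. ((1 / fact k) *\<^sub>R mpow A k) $ i $ j) sums (mexp A $ i $ j)"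
proof -
  have "(\<lambda>n. (\<Sum>k<n. (1 / fact k) *\<^sub>R mpow A k) $ i $ j) \<longlonglongrightarrow> mexp A $ i $ j"
    using mexp_sums[of A] unfolding sums_def by (intro tendsto_vec_nth)
  then show ?thesis by (simp add: sums_def)
qed

lemma mpow_comm:
  assumes "X ** Y = Y ** X"
  shows "mpow X k ** Y = Y ** mpow X k"
proof (induction k)
  case (Suc k)
  have "mpow X (Suc k) ** Y = X ** (mpow X k ** Y)" by (simp add: matrix_mul_assoc)
  also have "\<dots> = Y ** mpow X (Suc k)" by (simp add: Suc matrix_mul_assoc assms)
  finally show ?case .
qed simp

lemma matrix_mul_sum_left: "Y ** (\<Sum>i\<in>I. f i) = (\<Sum>i\<in>I. Y ** (f i :: real^'m^'m))"
  by (induction I rule: infinite_finite_induct) (auto simp: matrix_add_ldistrib)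

lemma matrix_mul_add_right: "(X + Y) ** Z = X ** Z + Y ** (Z :: real^'m^'m)"
  by (simp add: vec_eq_iff matrix_matrix_mult_def algebra_simps sum.distrib)

lemma matrix_mul_scaleR: "Y ** (c *\<^sub>R Z) = c *\<^sub>R (Y ** (Z :: real^'m^'m))" "(c *\<^sub>R Y) ** Z = c *\<^sub>R (Y ** Z)"
  by (simp_all add: vec_eq_iff matrix_matrix_mult_def sum_distrib_left mult_ac)

lemma matrix_mul_diff:
  fixes X Y Z :: "'a::comm_ring_1^'m^'m"
  shows "(X - Y) ** Z = X ** Z - Y ** Z" "Z ** (X - Y) = Z ** X - Z ** Y"
  by (simp_all add: vec_eq_iff matrix_matrix_mult_def left_diff_distrib right_diff_distrib
      sum_subtractf)

text \<open>The binomial theorem divided by \<open>fact n\<close>. The induction avoids binomial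
  coefficients by using the recursion (k+1) S(k+1) = Z S(k) for the normalised powers.\<close>

lemma mexp_series_add_commuting:
  fixes X Y :: "real^'m^'m"
  assumes comm: "X ** Y = Y ** X"
  defines "S \<equiv> \<lambda>Z k. (1 / fact k) *\<^sub>R mpow Z k"
  shows "S (X + Y) n = (\<Sum>i\<le>n. S X i ** S Y (n - i))"
proof (induction n)
  case 0
  show ?case by (simp add: S_def)
next
  case (Suc n)
  have S_Suc: "real (Suc k) *\<^sub>R S Z (Suc k) = Z ** S Z k" for Z k
    by (simp add: S_def matrix_mul_scaleR del: of_nat_Suc)
  have S_comm: "Y ** S X k = S X k ** Y" for k
    by (simp add: S_def matrix_mul_scaleR mpow_comm[OF comm])
  have "real (Suc n) *\<^sub>R S (X + Y) (Suc n) = (X + Y) ** (\<Sum>i\<le>n. S X i ** S Y (n - i))"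
    by (simp only: S_Suc Suc)
  also have "\<dots> = (\<Sum>i\<le>n. (X ** S X i) ** S Y (n - i)) + (\<Sum>i\<le>n. S X i ** (Y ** S Y (n - i)))"
    by (simp add: matrix_mul_add_right matrix_mul_sum_left matrix_mul_assoc S_comm sum.distrib)
  also have "\<dots> = (\<Sum>i\<le>n. real (Suc i) *\<^sub>R (S X (Suc i) ** S Y (n - i)))
      + (\<Sum>i\<le>n. real (Suc n - i) *\<^sub>R (S X i ** S Y (Suc n - i)))"
    by (simp add: Suc_diff_le S_Suc[symmetric] matrix_mul_scaleR del: of_nat_Suc)
  \<comment> \<open>Shift the first sum by one and extend both to \<open>Suc n\<close>: the added
    terms have weight 0. The weights \<open>i\<close> and \<open>Suc n - i\<close> then add up to
    \<open>Suc n\<close>.\<close>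
  also have "\<dots> = (\<Sum>i\<le>Suc n. real i *\<^sub>R (S X i ** S Y (Suc n - i)))
      + (\<Sum>i\<le>Suc n. real (Suc n - i) *\<^sub>R (S X i ** S Y (Suc n - i)))"
    by (subst sum.atMost_Suc_shift) simp
  also have "\<dots> = (\<Sum>i\<le>Suc n. real (Suc n) *\<^sub>R (S X i ** S Y (Suc n - i)))"
    by (simp only: sum.distrib [symmetric] scaleR_left_distrib [symmetric]
        of_nat_add [symmetric]) simp
  also have "\<dots> = real (Suc n) *\<^sub>R (\<Sum>i\<le>Suc n. S X i ** S Y (Suc n - i))"
    by (simp only: scaleR_right.sum)
  finally show ?case
    by (simp del: sum.cl_ivl_Suc of_nat_Suc)
qed

text \<open>The Cauchy product is applied to scalar series, one for each inner index
  \<open>l\<close> of the matrix product, and the results are summed over \<open>l\<close>.\<close>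

lemma mexp_add:
  fixes X Y :: "real^'m^'m"
  assumes comm: "X ** Y = Y ** X"
  shows "mexp (X + Y) = mexp X ** mexp Y"
proof -
  define S where "S = (\<lambda>(Z::real^'m^'m) k. (1 / fact k) *\<^sub>R mpow Z k)"
  have ent: "(\<lambda>k. S Z k $ i $ j) sums (mexp Z $ i $ j)" for Z i j
    unfolding S_def by (rule mexp_entry_sums)
  have abs: "summable (\<lambda>k. norm (S Z k $ i $ j))" for Z i j
    unfolding S_def by (rule summable_mexp_entry)
  have "mexp (X + Y) $ i $ j = (mexp X ** mexp Y) $ i $ j" for i j
  proof -
    have "(\<lambda>k. \<Sum>p\<le>k. S X p $ i $ l * S Y (k - p) $ l $ j) sums (mexp X $ i $ l * mexp Y $ l $ j)" for l
      using Cauchy_product_sums[OF abs[of X i l] abs[of Y l j]]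
      by (simp add: sums_unique[OF ent, symmetric])
    then have "(\<lambda>k. \<Sum>l\<in>UNIV. \<Sum>p\<le>k. S X p $ i $ l * S Y (k - p) $ l $ j) sums
        (\<Sum>l\<in>UNIV. mexp X $ i $ l * mexp Y $ l $ j)"
      by (intro sums_sum) auto
    moreover have "(\<Sum>l\<in>UNIV. \<Sum>p\<le>k. S X p $ i $ l * S Y (k - p) $ l $ j) = S (X + Y) k $ i $ j" for k
      unfolding S_def mexp_series_add_commuting[OF comm]
      by (simp add: matrix_matrix_mult_def sum.swap[of _ UNIV])
    ultimately have "(\<lambda>k. S (X + Y) k $ i $ j) sums (mexp X ** mexp Y) $ i $ j"
      by (simp add: matrix_matrix_mult_def)
    then show ?thesis
      using ent sums_unique2 by blast
  qed
  then show ?thesis by (simp add: vec_eq_iff)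
qed

lemma mexp_0 [simp]: "mexp 0 = (mat 1 :: real^'m^'m)"
proof -
  have "(\<lambda>k. (1 / fact k) *\<^sub>R mpow (0::real^'m^'m) k) sums (\<Sum>k\<in>{0}. (1 / fact k) *\<^sub>R mpow 0 k)"
  proof (rule sums_finite)
    show "(1 / fact k) *\<^sub>R mpow (0::real^'m^'m) k = 0" if "k \<notin> {0}" for k
      using that by (cases k) (auto simp: vec_eq_iff matrix_matrix_mult_def)
  qed auto
  then show ?thesis
    using sums_unique2[OF mexp_sums] by simp
qed

lemma mpow_transpose: "mpow (transpose X) k = transpose (mpow (X::real^'m^'m) k)"
proof (induction k)
  case (Suc k)
  then show ?case by (simp add: matrix_transpose_mul[symmetric] mpow_comm)
qed (simp add: transpose_mat)

lemma mexp_transpose: "mexp (transpose X) = transpose (mexp (X::real^'m^'m))"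
proof -
  have "mexp (transpose X) $ i $ j = transpose (mexp X) $ i $ j" for i j
    using mexp_entry_sums[of "transpose X" i j] mexp_entry_sums[of X j i]
    by (simp add: mpow_transpose sums_unique2) (simp add: transpose_def sums_unique2)
  then show ?thesis by (simp add: vec_eq_iff)
qed

lemma mexp_diagonal: "mexp (\<chi> i j. if i = j then c i else 0) = (\<chi> i j. if i = j then exp (c i) else 0)"
proof -
  have P: "mpow (\<chi> i j. if i = j then c i else 0) k = (\<chi> i j. if i = j then c i ^ k else 0)" for k
    by (induction k) (auto simp: vec_eq_iff mat_def matrix_matrix_mult_def if_distrib[where f="\<lambda>x. _ * x"] if_distrib[where f="\<lambda>x. x * _"] cong: if_cong)
  have "mexp (\<chi> i j. if i = j then c i else 0) $ i $ j = (if i = j then exp (c i) else 0)" for i j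
    using mexp_entry_sums[of "\<chi> i j. if i = j then c i else 0" i j] exp_converges[of "c i"]
    by (auto simp: P divide_inverse sums_unique2 split: if_splits)
  then show ?thesis by (simp add: vec_eq_iff)
qed

text \<open>Each entry is a power series in \<open>t\<close> that converges everywhere.\<close>

lemma continuous_mexp_line: "continuous_on S (\<lambda>t. mexp (t *\<^sub>R (A::real^'m^'m)))"
proof -
  have P: "mpow (t *\<^sub>R A) k = t ^ k *\<^sub>R mpow A k" for t k
    by (induction k) (auto simp: matrix_mul_scaleR)
  have "continuous_on S (\<lambda>t. mexp (t *\<^sub>R A) $ i $ j)" for i j
  proof -
    let ?a = "\<lambda>k. mpow A k $ i $ j / fact k"
    have s: "(\<lambda>k. ?a k * t ^ k) sums (mexp (t *\<^sub>R A) $ i $ j)" for t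
      using mexp_entry_sums[of "t *\<^sub>R A" i j] by (simp add: P mult.commute)
    have eq: "mexp (t *\<^sub>R A) $ i $ j = (\<Sum>k. ?a k * t ^ k)" for t
      using s by (rule sums_unique)
    have "isCont (\<lambda>t. \<Sum>k. ?a k * t ^ k) t" for t
      using s[of "\<bar>t\<bar> + 1"] by (intro isCont_powser[where K="\<bar>t\<bar> + 1"]) (auto simp: sums_iff)
    then show ?thesis by (simp add: eq continuous_at_imp_continuous_on)
  qed
  then have "continuous_on S (\<lambda>t. \<chi> i j. mexp (t *\<^sub>R A) $ i $ j)"
    by (intro continuous_on_vec_lambda)
  then show ?thesis by simp
qed

lemma mexp_line_add: "mexp ((s + t) *\<^sub>R (A::real^'m^'m)) = mexp (s *\<^sub>R A) ** mexp (t *\<^sub>R A)"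
  by (simp add: scaleR_left_distrib mexp_add matrix_mul_scaleR)

section \<open>Lattices in the semidirect product\<close>

lemma matrix_vector_mult_uminus: "M *v (- x) = - (M *v x)" for M :: "real^'n^'m"
  by (simp add: vec_eq_iff matrix_vector_mult_def sum_negf)

section \<open>Group law, cosets and the quotient topology\<close>

lemma gmul_assoc: "gmul A (gmul A x y) z = gmul A x (gmul A y z)"
  by (simp add: gmul_def mexp_line_add matrix_vector_mul_assoc matrix_vector_right_distrib add.assoc)

lemma gmul_0 [simp]: "gmul A (0, 0) x = x" "gmul A x (0, 0) = x"
  by (simp_all add: gmul_def)

lemma mexp_line_minus: "mexp (t *\<^sub>R A) ** mexp ((- t) *\<^sub>R A) = mat 1"
  using mexp_line_add[of t "- t" A] by simp

lemma gmul_ginv: "gmul A x (ginv A x) = (0, 0)"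
  using mexp_line_minus[of "fst x" A]
  by (simp add: gmul_def ginv_def matrix_vector_mult_uminus matrix_vector_mul_assoc)

lemma ginv_gmul: "gmul A (ginv A x) x = (0, 0)"
  by (simp add: gmul_def ginv_def)

lemma rcoset_self: "is_subgroup A \<Gamma> \<Longrightarrow> g \<in> rcoset A \<Gamma> g"
  unfolding rcoset_def is_subgroup_def by (metis gmul_0(1) image_eqI)

lemma rcoset_eqI:
  assumes "is_subgroup A \<Gamma>" "g' \<in> rcoset A \<Gamma> g"
  shows "rcoset A \<Gamma> g' = rcoset A \<Gamma> g"
proof -
  from assms(2) obtain h where h: "h \<in> \<Gamma>" "g' = gmul A h g" by (auto simp: rcoset_def)
  have 1: "gmul A k g' = gmul A (gmul A k h) g" for k by (simp add: h gmul_assoc)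
  have 2: "gmul A k g = gmul A (gmul A k (ginv A h)) g'" for k
    by (metis 1 gmul_0(2) gmul_assoc ginv_gmul)
  show ?thesis
  proof
    show "rcoset A \<Gamma> g' \<subseteq> rcoset A \<Gamma> g"
      using assms(1) h(1) 1 unfolding rcoset_def is_subgroup_def by blast
    show "rcoset A \<Gamma> g \<subseteq> rcoset A \<Gamma> g'"
      using assms(1) h(1) 2 unfolding rcoset_def is_subgroup_def by blast
  qed
qed

text \<open>Unfolding \<open>topology\<close> requires the axioms of a topology for the family of
  open sets.\<close>

lemma openin_quot_top:
  assumes "is_subgroup A \<Gamma>"
  shows "openin (quot_top A \<Gamma>) U \<longleftrightarrow> U \<subseteq> range (rcoset A \<Gamma>) \<and> open (\<Union>U)"
proof -
  have "istopology (\<lambda>U. U \<subseteq> range (rcoset A \<Gamma>) \<and> open (\<Union>U))"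
    unfolding istopology_def
  proof (intro conjI allI impI)
    fix S T assume ST: "S \<subseteq> range (rcoset A \<Gamma>) \<and> open (\<Union>S)" "T \<subseteq> range (rcoset A \<Gamma>) \<and> open (\<Union>T)"
    then show "S \<inter> T \<subseteq> range (rcoset A \<Gamma>)" by blast
    \<comment> \<open>Two cosets with a common point coincide, so forming the union commutes with
      intersecting families of cosets.\<close>
    have "\<Union>(S \<inter> T) = \<Union>S \<inter> \<Union>T"
    proof
      show "\<Union>S \<inter> \<Union>T \<subseteq> \<Union>(S \<inter> T)"
      proof
        fix x assume "x \<in> \<Union>S \<inter> \<Union>T"
        then obtain a b where ab: "a \<in> S" "x \<in> a" "b \<in> T" "x \<in> b" by blast
        then obtain g h where "a = rcoset A \<Gamma> g" "b = rcoset A \<Gamma> h" using ST by blast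
        then have "a = b" using ab rcoset_eqI[OF assms] by metis
        then show "x \<in> \<Union>(S \<inter> T)" using ab by blast
      qed
    qed blast
    then show "open (\<Union>(S \<inter> T))" using ST by auto
  next
    fix K assume K: "\<forall>S\<in>K. S \<subseteq> range (rcoset A \<Gamma>) \<and> open (\<Union>S)"
    then show "\<Union>K \<subseteq> range (rcoset A \<Gamma>)" by blast
    have "\<Union>(\<Union>K) = (\<Union>S\<in>K. \<Union>S)" by blast
    then show "open (\<Union>(\<Union>K))" using K by auto
  qed
  then show ?thesis by (simp add: quot_top_def topology_inverse')
qed

text \<open>Left translation is a homeomorphism: an image under it is a preimage under translation
  by \<open>ginv A x\<close>.\<close>

lemma open_gmul_image:
  assumes "open S"
  shows "open (gmul A x ` S)"
proof -
  have "gmul A x ` S = gmul A (ginv A x) -` S"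
  proof
    show "gmul A x ` S \<subseteq> gmul A (ginv A x) -` S"
      by (auto simp flip: gmul_assoc simp: ginv_gmul)
    show "gmul A (ginv A x) -` S \<subseteq> gmul A x ` S"
    proof
      fix y assume "y \<in> gmul A (ginv A x) -` S"
      moreover have "y = gmul A x (gmul A (ginv A x) y)" by (simp flip: gmul_assoc add: gmul_ginv)
      ultimately show "y \<in> gmul A x ` S" by auto
    qed
  qed
  moreover have "continuous_on UNIV (gmul A (ginv A x))"
    unfolding gmul_def matrix_vector_mult_def by (intro continuous_intros)
  ultimately show ?thesis using assms by (simp add: open_vimage)
qed

text \<open>The images in the quotient of the balls of integer radius about 0 form an open cover; by
  compactness finitely many suffice, and the largest radius is \<open>r\<close>.\<close>

lemma lattice_bounded_fundamental_domain:
  assumes "is_lattice A \<Gamma>"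
  obtains r where "r > 0" "\<And>g. \<exists>\<gamma>\<in>\<Gamma>. \<exists>k. norm k < r \<and> g = gmul A \<gamma> k"
proof -
  have sub: "is_subgroup A \<Gamma>" and comp: "compact_space (quot_top A \<Gamma>)"
    using assms by (auto simp: is_lattice_def)
  define U where "U n = rcoset A \<Gamma> ` ball 0 (real n)" for n :: nat
  have "\<Union>(U n) = (\<Union>\<gamma>\<in>\<Gamma>. gmul A \<gamma> ` ball 0 (real n))" for n
    by (auto simp: U_def rcoset_def)
  then have "open (\<Union>(U n))" for n by (simp add: open_gmul_image open_UN)
  then have op: "openin (quot_top A \<Gamma>) (U n)" for n
    by (auto simp: openin_quot_top[OF sub] U_def)
  have top: "topspace (quot_top A \<Gamma>) \<subseteq> range (rcoset A \<Gamma>)"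
    using openin_topspace[of "quot_top A \<Gamma>"] openin_quot_top[OF sub] by blast
  have cov: "rcoset A \<Gamma> g \<in> \<Union>(range U)" for g
  proof -
    obtain n :: nat where "norm g < real n" using reals_Archimedean2 by blast
    then show ?thesis unfolding U_def by (intro UnionI[of "U n"]) (auto simp: U_def)
  qed
  have "topspace (quot_top A \<Gamma>) = range (rcoset A \<Gamma>)"
  proof
    show "range (rcoset A \<Gamma>) \<subseteq> topspace (quot_top A \<Gamma>)"
      using cov openin_subset[OF op] by blast
  qed (rule top)
  moreover obtain F where F: "finite F" "F \<subseteq> range U" "topspace (quot_top A \<Gamma>) \<subseteq> \<Union>F"
  proof -
    have "topspace (quot_top A \<Gamma>) \<subseteq> \<Union>(range U)" using cov top by blast
    moreover have "\<forall>V\<in>range U. openin (quot_top A \<Gamma>) V" using op by blast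
    ultimately show ?thesis using comp that unfolding compact_space_alt by meson
  qed
  ultimately have all: "rcoset A \<Gamma> g \<in> \<Union>F" for g by blast
  obtain I where I: "finite I" "F = U ` I" using F(1,2) finite_subset_image by metis
  \<comment> \<open>Inserting 1 keeps \<open>Max\<close> meaningful for empty \<open>I\<close> and
    makes \<open>r\<close> positive.\<close>
  define r where "r = real (Max (insert 1 I))"
  show ?thesis
  proof (rule that)
    show "r > 0" using I by (auto simp: r_def Max_gr_iff)
    fix g
    obtain n where n: "n \<in> I" "rcoset A \<Gamma> g \<in> U n" using all[of g] I by blast
    then obtain k where k: "norm k < real n" "rcoset A \<Gamma> g = rcoset A \<Gamma> k" by (auto simp: U_def)
    have "g \<in> rcoset A \<Gamma> k" using rcoset_self[OF sub, of g] k by simp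
    then obtain \<gamma> where "\<gamma> \<in> \<Gamma>" "g = gmul A \<gamma> k" by (auto simp: rcoset_def)
    moreover have "real n \<le> r" using n I by (simp add: r_def)
    then have "norm k < r" using k(1) by simp
    ultimately show "\<exists>\<gamma>\<in>\<Gamma>. \<exists>k. norm k < r \<and> g = gmul A \<gamma> k" by blast
  qed
qed

section \<open>The intersection of the lattice with the abelian ideal\<close>

lemma span_UNIV_if_relatively_dense:
  fixes L :: "'a::euclidean_space set"
  assumes "\<And>u. \<exists>l\<in>L. norm (u - l) \<le> C"
  shows "span L = UNIV"
proof (rule ccontr)
  assume "span L \<noteq> UNIV"
  then have "span L \<subset> UNIV" by blast
  then obtain a where a: "a \<noteq> 0" "\<And>x. x \<in> span L \<Longrightarrow> a \<bullet> x = 0"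
    using orthogonal_to_subspace_exists_gen[of L UNIV] by (auto simp: orthogonal_def)
  \<comment> \<open>A multiple of the normal vector \<open>a\<close> of length |C| + 1: since
    \<open>a\<close> is orthogonal to \<open>L\<close>, this point is farther than \<open>C\<close>
    from all of \<open>L\<close>.\<close>
  define u where "u = ((\<bar>C\<bar> + 1) / (norm a)) *\<^sub>R a"
  obtain l where l: "l \<in> L" "norm (u - l) \<le> C" using assms by blast
  have "a \<bullet> (u - l) = (\<bar>C\<bar> + 1) * norm a"
    using a(1) a(2)[OF span_base[OF l(1)]] by (simp add: u_def inner_diff_right power2_norm_eq_inner[symmetric] power2_eq_square)
  moreover have "a \<bullet> (u - l) \<le> norm a * norm (u - l)" by (rule norm_cauchy_schwarz)
  moreover have "norm a * norm (u - l) \<le> norm a * C" using l(2) by (simp add: mult_left_mono)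
  ultimately have "(\<bar>C\<bar> + 1) * norm a \<le> C * norm a" by (simp add: mult.commute)
  with a(1) show False by simp
qed

lemma mexp_line_orbit_bounded:
  fixes A :: "real^'m^'m"
  obtains C where "\<And>t y. \<bar>t\<bar> \<le> r \<Longrightarrow> norm y \<le> r \<Longrightarrow> norm (mexp (t *\<^sub>R A) *v y) \<le> C"
proof -
  let ?f = "\<lambda>p::real \<times> (real^'m). mexp (fst p *\<^sub>R A) *v snd p"
  let ?K = "{- r..r} \<times> cball (0::real^'m) r"
  have E: "continuous_on ?K (\<lambda>p. mexp (fst p *\<^sub>R A))"
    by (rule continuous_on_compose2[OF continuous_mexp_line[of UNIV A]]) (auto intro: continuous_intros)
  have "continuous_on ?K ?f"
    unfolding matrix_vector_mult_def by (intro continuous_intros E)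
  moreover have "compact ?K" by (intro compact_Times) auto
  ultimately have "bounded (?f ` ?K)" using compact_continuous_image compact_imp_bounded by blast
  then obtain C where C: "\<And>p. p \<in> ?K \<Longrightarrow> norm (?f p) \<le> C" unfolding bounded_iff by blast
  show ?thesis
  proof (rule that)
    show "norm (mexp (t *\<^sub>R A) *v y) \<le> C" if "\<bar>t\<bar> \<le> r" "norm y \<le> r" for t y
      using C[of "(t, y)"] that by (simp add: abs_le_iff)
  qed
qed

text \<open>The commutators of a fixed lattice element \<open>(t, v)\<close>, \<open>t \<noteq> 0\<close>, with the elements of the
  lattice lying over a bounded interval form a relatively dense subset of the abelian ideal,
  because \<open>exp (t A) - 1\<close> is invertible.\<close>

lemma lattice_meets_ideal:
  fixes A :: "real^'m^'m"
  assumes lat: "is_lattice A \<Gamma>" and inv: "\<And>t. t \<noteq> 0 \<Longrightarrow> det (mat 1 - mexp (t *\<^sub>R A)) \<noteq> 0"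
  obtains t e L where "t \<noteq> 0" "0 \<in> L" "\<And>x y. x \<in> L \<Longrightarrow> y \<in> L \<Longrightarrow> x - y \<in> L"
    "e > 0" "\<And>x. x \<in> L \<Longrightarrow> norm x < e \<Longrightarrow> x = 0" "span L = UNIV"
    "\<And>x. x \<in> L \<Longrightarrow> mexp (t *\<^sub>R A) *v x \<in> L"
proof -
  have sub: "is_subgroup A \<Gamma>" and disc: "discrete_set \<Gamma>" using lat by (auto simp: is_lattice_def)
  have G0: "(0, 0) \<in> \<Gamma>" and Gm: "\<And>x y. x \<in> \<Gamma> \<Longrightarrow> y \<in> \<Gamma> \<Longrightarrow> gmul A x y \<in> \<Gamma>"
    and Gi: "\<And>x. x \<in> \<Gamma> \<Longrightarrow> ginv A x \<in> \<Gamma>" using sub by (auto simp: is_subgroup_def)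
  obtain r where r: "r > 0" "\<And>g. \<exists>\<gamma>\<in>\<Gamma>. \<exists>k. norm k < r \<and> g = gmul A \<gamma> k"
    using lattice_bounded_fundamental_domain[OF lat] by blast
  define E where "E t = mexp (t *\<^sub>R A)" for t
  have EE: "E t *v (E (- t) *v v) = v" for t v
    using mexp_line_minus[of t A] by (simp add: E_def matrix_vector_mul_assoc)
  have quot: "(0, v - w) \<in> \<Gamma>" if "(t, v) \<in> \<Gamma>" "(t, w) \<in> \<Gamma>" for t v w
  proof -
    have "gmul A (t, v) (ginv A (t, w)) = (0, v - w)"
      using EE[of t w] by (simp add: gmul_def ginv_def E_def matrix_vector_mult_uminus)
    then show ?thesis using Gm[OF that(1) Gi[OF that(2)]] by simp
  qed
  \<comment> \<open>Write \<open>(r, 0)\<close> as \<gamma> times \<open>k\<close> with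
    \<open>norm k < r\<close>: the first coordinate of \<open>k\<close> is too small to account for
    \<open>r\<close>, so that of \<gamma> is nonzero.\<close>
  obtain t1 v1 where g1: "(t1, v1) \<in> \<Gamma>" "t1 \<noteq> 0"
  proof -
    obtain \<gamma> k where k: "\<gamma> \<in> \<Gamma>" "norm k < r" "(r, 0) = gmul A \<gamma> k" using r(2) by blast
    have "\<bar>fst k\<bar> \<le> norm k" by (metis norm_fst_le prod.collapse real_norm_def)
    with k have "fst \<gamma> \<noteq> 0" by (auto simp: gmul_def)
    then show ?thesis using that[of "fst \<gamma>" "snd \<gamma>"] k(1) by simp
  qed
  define L where "L = {w. (0, w) \<in> \<Gamma>}"
  define T where "T = E t1"
  obtain e where e: "e > 0" "\<And>y. y \<in> \<Gamma> \<Longrightarrow> dist y (0, 0) < e \<Longrightarrow> y = (0, 0)"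
    using disc G0 unfolding discrete_set_def by metis
  obtain C where C: "\<And>t y. \<bar>t\<bar> \<le> r \<Longrightarrow> norm y \<le> r \<Longrightarrow> norm (E t *v y) \<le> C"
    using mexp_line_orbit_bounded[of r A] unfolding E_def by blast
  \<comment> \<open>The enlarged radius admits \<open>v1\<close> itself as an argument.\<close>
  obtain C1 where C1: "\<And>t y. \<bar>t\<bar> \<le> max r (norm v1) \<Longrightarrow> norm y \<le> max r (norm v1) \<Longrightarrow> norm (E t *v y) \<le> C1"
    using mexp_line_orbit_bounded[of "max r (norm v1)" A] unfolding E_def by blast
  obtain Q where Q: "\<And>v. (mat 1 - T) *v (Q *v v) = v"
    using inv[OF g1(2)] unfolding T_def E_def
    by (metis invertible_det_nz invertible_right_inverse matrix_vector_mul_assoc matrix_vector_mul_lid)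
  obtain B where B: "\<And>y. norm ((mat 1 - T) *v y) \<le> norm y * B"
    using bounded_linear.bounded[OF matrix_vector_mul_bounded_linear[of "mat 1 - T"]] by blast
  show ?thesis
  proof (rule that)
    show "t1 \<noteq> 0" by fact
    show "0 \<in> L" using G0 by (simp add: L_def)
    show "x - y \<in> L" if "x \<in> L" "y \<in> L" for x y using quot that by (simp add: L_def)
    show "e > 0" by fact
    show "x = 0" if "x \<in> L" "norm x < e" for x
      using e(2)[of "(0, x)"] that by (simp add: L_def dist_Pair_Pair)
    show "mexp (t1 *\<^sub>R A) *v x \<in> L" if "x \<in> L" for x
    proof -
      have "gmul A (t1, v1) (0, x) \<in> \<Gamma>" using Gm g1(1) that by (simp add: L_def)
      then have "(t1, v1 + mexp (t1 *\<^sub>R A) *v x) \<in> \<Gamma>" by (simp add: gmul_def)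
      from quot[OF this g1(1)] show ?thesis by (simp add: L_def)
    qed
    show "span L = UNIV"
    proof (rule span_UNIV_if_relatively_dense)
      fix u
      \<comment> \<open>Up to a bounded error, taking the commutator with \<open>(t1, v1)\<close>
        acts on the second coordinate as -(1 - T). Reducing \<open>(0, Q *v (- u))\<close> modulo
        the lattice therefore yields an element whose commutator is close to
        \<open>u\<close>.\<close>
      obtain \<gamma> k where k: "\<gamma> \<in> \<Gamma>" "norm k < r" "(0, Q *v (- u)) = gmul A \<gamma> k" using r(2) by blast
      obtain t v where tv: "\<gamma> = (t, v)" by force
      obtain s y where sy: "k = (s, y)" by force
      have "\<bar>s\<bar> \<le> norm k" "norm y \<le> norm k" unfolding sy by (metis norm_fst_le real_norm_def, metis norm_snd_le)
      moreover have "t = - s" and w: "Q *v (- u) = v + E t *v y"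
        using k(3) by (auto simp: tv sy gmul_def E_def)
      ultimately have bnd: "\<bar>t\<bar> \<le> r" "norm y \<le> r" using k(2) by auto
      \<comment> \<open>The two products have the same first coordinate, so their quotient, a
        commutator, lies in the ideal.\<close>
      have "gmul A (t1, v1) (t, v) \<in> \<Gamma>" "gmul A (t, v) (t1, v1) \<in> \<Gamma>" using Gm g1(1) k(1) tv by auto
      then have "(t1 + t, v1 + T *v v) \<in> \<Gamma>" "(t1 + t, v + E t *v v1) \<in> \<Gamma>"
        by (simp_all add: gmul_def T_def E_def add.commute)
      then have "(v1 + T *v v) - (v + E t *v v1) \<in> L" using quot by (simp add: L_def)
      moreover have "u - ((v1 + T *v v) - (v + E t *v v1)) = E t *v v1 - v1 - (mat 1 - T) *v (E t *v y)"
      proof -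
        have "- u = (mat 1 - T) *v (v + E t *v y)" using Q[of "- u"] w by simp
        then have "u = - ((mat 1 - T) *v (v + E t *v y))" by (metis add.inverse_inverse)
        then have "u = - ((mat 1 - T) *v v) - (mat 1 - T) *v (E t *v y)"
          by (simp add: matrix_vector_right_distrib)
        then show ?thesis by (simp add: matrix_vector_mult_diff_rdistrib)
      qed
      moreover have "norm (E t *v v1 - v1 - (mat 1 - T) *v (E t *v y)) \<le> C1 + norm v1 + C * \<bar>B\<bar>"
      proof -
        have "norm ((mat 1 - T) *v (E t *v y)) \<le> norm (E t *v y) * B" by (rule B)
        also have "\<dots> \<le> norm (E t *v y) * \<bar>B\<bar>" by (intro mult_left_mono) auto
        also have "\<dots> \<le> C * \<bar>B\<bar>" using C[OF bnd] by (intro mult_right_mono) auto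
        finally have "norm ((mat 1 - T) *v (E t *v y)) \<le> C * \<bar>B\<bar>" .
        moreover have "norm (E t *v v1) \<le> C1" using bnd(1) by (intro C1) auto
        ultimately show ?thesis
          using norm_triangle_ineq4[of "E t *v v1 - v1" "(mat 1 - T) *v (E t *v y)"]
            norm_triangle_ineq4[of "E t *v v1" v1] by linarith
      qed
      ultimately show "\<exists>l\<in>L. norm (u - l) \<le> C1 + norm v1 + C * \<bar>B\<bar>" by metis
    qed
  qed
qed

section \<open>Bases of lattices in Euclidean space\<close>

lemma subgroup_int_combination:
  fixes L :: "'a::real_vector set" and z :: "'i \<Rightarrow> int"
  assumes "0 \<in> L" "\<And>x y. x \<in> L \<Longrightarrow> y \<in> L \<Longrightarrow> x - y \<in> L" "\<And>i. i \<in> I \<Longrightarrow> b i \<in> L"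
  shows "(\<Sum>i\<in>I. real_of_int (z i) *\<^sub>R b i) \<in> L"
proof -
  have neg: "- x \<in> L" if "x \<in> L" for x using assms(2)[OF assms(1) that] by simp
  have add: "x + y \<in> L" if "x \<in> L" "y \<in> L" for x y using assms(2)[OF that(1) neg[OF that(2)]] by simp
  have nat: "real k *\<^sub>R x \<in> L" if "x \<in> L" for k x
    by (induction k) (auto simp: assms(1) scaleR_left_distrib add that)
  have int: "real_of_int k *\<^sub>R x \<in> L" if "x \<in> L" for k x
  proof (cases "k \<ge> 0")
    case True
    then show ?thesis using nat[OF that, of "nat k"] by simp
  next
    case False
    then show ?thesis using neg[OF nat[OF that, of "nat (- k)"]] by simp
  qed
  show ?thesis
    using assms(3) by (induction I rule: infinite_finite_induct) (auto simp: assms(1) intro!: add int)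
qed

text \<open>Cover the ball by finitely many balls of radius \<open>e / 2\<close>. Each contains at
  most one point of \<open>L\<close>, since a difference of two would be shorter than
  \<open>e\<close>.\<close>

lemma finite_bounded_discrete_subgroup:
  fixes L :: "'a::euclidean_space set"
  assumes sub: "\<And>x y. x \<in> L \<Longrightarrow> y \<in> L \<Longrightarrow> x - y \<in> L"
    and e: "e > 0" "\<And>x. x \<in> L \<Longrightarrow> norm x < e \<Longrightarrow> x = 0"
  shows "finite {x \<in> L. norm x \<le> R}"
proof -
  have "compact (cball (0::'a) R)" by simp
  then obtain K where K: "finite K" "cball (0::'a) R \<subseteq> (\<Union>x\<in>K. ball x (e / 2))"
    unfolding compact_eq_totally_bounded using e(1) half_gt_zero by blast
  define c where "c x = (SOME k. k \<in> K \<and> x \<in> ball k (e / 2))" for x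
  have c: "c x \<in> K" "dist (c x) x < e / 2" if "x \<in> {x \<in> L. norm x \<le> R}" for x
  proof -
    have "\<exists>k. k \<in> K \<and> x \<in> ball k (e / 2)" using subsetD[OF K(2), of x] that by (simp add: mem_ball) blast
    from someI_ex[OF this] show "c x \<in> K" "dist (c x) x < e / 2" unfolding c_def by auto
  qed
  have "inj_on c {x \<in> L. norm x \<le> R}"
  proof (rule inj_onI)
    fix x y assume x: "x \<in> {x \<in> L. norm x \<le> R}" and y: "y \<in> {x \<in> L. norm x \<le> R}" and eq: "c x = c y"
    have "dist x y < e" using dist_triangle_half_r[OF c(2)[OF x]] c(2)[OF y] eq by (metis)
    then show "x = y" using e(2)[of "x - y"] sub x y by (simp add: dist_norm)
  qed
  moreover have "c ` {x \<in> L. norm x \<le> R} \<subseteq> K" using c(1) by auto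
  ultimately show ?thesis using K(1) by (rule inj_on_finite)
qed

lemma spanning_set_contains_basis_matrix:
  fixes L :: "(real^'m) set"
  assumes "span L = UNIV"
  obtains P :: "real^'m^'m" where "det P \<noteq> 0" "\<And>j. column j P \<in> L"
proof -
  obtain B where B: "B \<subseteq> L" "independent B" "L \<subseteq> span B"
    using maximal_independent_subset by blast
  have sB: "span B = UNIV" using assms B(3) by (metis span_mono span_span top.extremum_uniqueI)
  have "finite B" using B(2) independent_imp_finite by blast
  have "card B = CARD('m)" using B(2) sB by (metis dim_UNIV dim_span_eq_card_independent DIM_cart DIM_real mult.right_neutral)
  then obtain b where b: "bij_betw b (UNIV :: 'm set) B"
    using \<open>finite B\<close> by (metis finite_same_card_bij finite)
  define P :: "real^'m^'m" where "P = (\<chi> i j. b j $ i)"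
  have col: "column j P = b j" for j by (simp add: P_def column_def vec_eq_iff)
  have "columns P = B" unfolding columns_def col using b by (auto simp: bij_betw_def)
  then have "invertible P"
    using sB by (simp add: invertible_right_inverse matrix_right_invertible_span_columns span_vec_eq)
  then have "det P \<noteq> 0" by (simp add: invertible_det_nz)
  moreover have "column j P \<in> L" for j unfolding col using b B(1) by (auto simp: bij_betw_def)
  ultimately show ?thesis using that by blast
qed

lemma det_nz_solve:
  fixes P :: "real^'m^'m"
  assumes "det P \<noteq> 0"
  obtains Q where "\<And>v. P *v (Q *v v) = v"
proof -
  have "invertible P" using assms by (simp add: invertible_det_nz)
  then show ?thesis
    using that by (metis invertible_right_inverse matrix_vector_mul_assoc matrix_vector_mul_lid)
qed

text \<open>Pigeonhole: two of the multiples of \<open>v\<close> agree modulo the sublattice spanned by the columns of \<open>P\<close>.\<close>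

lemma sublattice_bounded_exponent:
  fixes L :: "(real^'m) set" and P :: "real^'m^'m"
  assumes zero: "0 \<in> L" and sub: "\<And>x y. x \<in> L \<Longrightarrow> y \<in> L \<Longrightarrow> x - y \<in> L"
    and e: "e > 0" "\<And>x. x \<in> L \<Longrightarrow> norm x < e \<Longrightarrow> x = 0"
    and P: "det P \<noteq> 0" "\<And>j. column j P \<in> L"
  obtains m :: nat where "m > 0" "\<And>v. v \<in> L \<Longrightarrow> \<exists>z::int^'m. real m *\<^sub>R v = P *v (\<chi> i. of_int (z $ i))"
proof -
  \<comment> \<open>A bound for the norm on the fundamental parallelepiped of \<open>P\<close>,
    where all the vectors \<open>g k\<close> below lie.\<close>
  define C where "C = (\<Sum>j\<in>UNIV. norm (column j P))"
  define W where "W = {x \<in> L. norm x \<le> C}"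
  have W: "finite W" unfolding W_def using finite_bounded_discrete_subgroup[OF sub e] .
  define K where "K = card W"
  obtain Q where Q: "\<And>v. P *v (Q *v v) = v" using det_nz_solve[OF P(1)] by blast
  have Pz: "P *v (\<chi> i. of_int (z $ i)) \<in> L" for z :: "int^'m"
    unfolding matrix_mult_sum
    using subgroup_int_combination[OF zero sub P(2), where I=UNIV and z="\<lambda>i. z $ i"] by (simp add: scalar_mult_eq_scaleR)
  \<comment> \<open>The pigeonhole multiple \<open>d\<close> depends on \<open>v\<close> but is at
    most \<open>K\<close>, so the factorial of \<open>K\<close> serves all \<open>v\<close> at
    once.\<close>
  have "\<exists>z::int^'m. real (fact K) *\<^sub>R v = P *v (\<chi> i. of_int (z $ i))" if v: "v \<in> L" for v
  proof -
    define c where "c = Q *v v"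
    define g where "g k = (P *v (\<chi> i. frac (real k * c $ i)))" for k :: nat
    have g: "g k = real k *\<^sub>R v - P *v (\<chi> i. of_int (\<lfloor>real k * c $ i\<rfloor>))" for k
    proof -
      have "(\<chi> i. frac (real k * c $ i)) = real k *\<^sub>R c - (\<chi> i. of_int (\<lfloor>real k * c $ i\<rfloor>))"
        by (simp add: vec_eq_iff frac_def)
      then show ?thesis
        by (simp add: g_def matrix_vector_mult_diff_distrib matrix_vector_mult_scaleR c_def Q)
    qed
    have "g k \<in> W" for k
    proof -
      have "real k *\<^sub>R v \<in> L"
        using subgroup_int_combination[OF zero sub, where I="{()}" and b="\<lambda>_. v" and z="\<lambda>_. int k"] v by simp
      moreover have "P *v (\<chi> i. of_int (\<lfloor>real k * c $ i\<rfloor>)) \<in> L" using Pz[of "\<chi> i. \<lfloor>real k * c $ i\<rfloor>"] by simp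
      ultimately have "g k \<in> L" unfolding g by (rule sub)
      moreover have "norm (g k) \<le> C"
        unfolding g_def matrix_mult_sum C_def
        by (rule order.trans[OF norm_sum], rule sum_mono)
           (simp add: scalar_mult_eq_scaleR mult_left_le_one_le frac_ge_0 less_imp_le[OF frac_lt_1])
      ultimately show ?thesis by (simp add: W_def)
    qed
    then have "g ` {0..K} \<subseteq> W" by auto
    then have "card (g ` {0..K}) \<le> K" using W card_mono K_def by blast
    then have "\<not> inj_on g {0..K}" by (intro pigeonhole) simp
    then obtain a b where ab: "a \<le> K" "b \<le> K" "g a = g b" "a < b"
      unfolding inj_on_def by (metis atLeastAtMost_iff linorder_neqE_nat)
    define d where "d = b - a"
    have "real d *\<^sub>R v = P *v ((\<chi> i. of_int (\<lfloor>real b * c $ i\<rfloor>)) - (\<chi> i. of_int (\<lfloor>real a * c $ i\<rfloor>)))"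
      using ab(3,4) unfolding g d_def by (simp add: matrix_vector_mult_diff_distrib of_nat_diff scaleR_left_diff_distrib algebra_simps)
    also have "\<dots> = P *v (\<chi> i. of_int (\<lfloor>real b * c $ i\<rfloor> - \<lfloor>real a * c $ i\<rfloor>))"
      by (rule arg_cong[where f="\<lambda>x. P *v x"]) (simp add: vec_eq_iff)
    finally have dv: "real d *\<^sub>R v = P *v (\<chi> i. of_int (\<lfloor>real b * c $ i\<rfloor> - \<lfloor>real a * c $ i\<rfloor>))" .
    have "d dvd fact K" using ab by (intro dvd_fact) (auto simp: d_def)
    then obtain q where q: "fact K = d * q" by blast
    have "real (fact K) *\<^sub>R v = real q *\<^sub>R (real d *\<^sub>R v)" unfolding q by (simp add: mult.commute)
    also have "\<dots> = P *v (\<chi> i. of_int ((\<chi> i. int q * (\<lfloor>real b * c $ i\<rfloor> - \<lfloor>real a * c $ i\<rfloor>)) $ i))"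
      unfolding dv matrix_vector_mult_scaleR[symmetric]
      by (rule arg_cong[where f="\<lambda>x. P *v x"]) (simp add: vec_eq_iff)
    finally show ?thesis by blast
  qed
  then show ?thesis using that[of "fact K"] by simp
qed

text \<open>Among the linearly independent column systems from \<open>L\<close>, take one with least
  |det|. The minimum exists because the values are natural multiples of a fixed constant. A vector
  with a non-integral coordinate would allow a column exchange that makes the determinant
  smaller.\<close>

lemma lattice_basis:
  fixes L :: "(real^'m) set"
  assumes zero: "0 \<in> L" and sub: "\<And>x y. x \<in> L \<Longrightarrow> y \<in> L \<Longrightarrow> x - y \<in> L"
    and e: "e > 0" "\<And>x. x \<in> L \<Longrightarrow> norm x < e \<Longrightarrow> x = 0" and span: "span L = UNIV"
  obtains P :: "real^'m^'m" where "det P \<noteq> 0" "\<And>j. column j P \<in> L"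
    "\<And>v. v \<in> L \<Longrightarrow> \<exists>z::int^'m. v = P *v (\<chi> i. of_int (z $ i))"
proof -
  obtain P0 :: "real^'m^'m" where P0: "det P0 \<noteq> 0" "\<And>j. column j P0 \<in> L"
    using spanning_set_contains_basis_matrix[OF span] by blast
  obtain m where m: "m > 0" "\<And>v. v \<in> L \<Longrightarrow> \<exists>z::int^'m. real m *\<^sub>R v = P0 *v (\<chi> i. of_int (z $ i))"
    using sublattice_bounded_exponent[OF zero sub e P0] by blast
  define c where "c = \<bar>det P0\<bar> / real m ^ CARD('m)"
  have c: "c > 0" using P0 m by (simp add: c_def)
  \<comment> \<open>After scaling by \<open>m\<close>, all columns are integer combinations of those
    of \<open>P0\<close>; the determinant of the coefficient matrix \<open>Z\<close> is an integer,
    and the scaling contributes the power of \<open>m\<close> in \<open>c\<close>.\<close>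
  have ex: "\<exists>k::nat. \<bar>det Q\<bar> = c * real k" if Q: "\<And>j. column j Q \<in> L" for Q :: "real^'m^'m"
  proof -
    obtain z :: "'m \<Rightarrow> int^'m" where z: "\<And>j. real m *\<^sub>R column j Q = P0 *v (\<chi> i. of_int (z j $ i))"
      using m(2)[OF Q] by metis
    define Z :: "int^'m^'m" where "Z = (\<chi> i j. z j $ i)"
    have "mat (real m) ** Q = P0 ** (\<chi> i j. of_int (Z $ i $ j))"
    proof -
      have "(mat (real m) ** Q) $ i $ j = (P0 ** (\<chi> i j. of_int (Z $ i $ j))) $ i $ j" for i j
        using arg_cong[OF z[of j], of "\<lambda>v. v $ i"]
        by (simp add: matrix_matrix_mult_def mat_def column_def matrix_vector_mult_def Z_def
            if_distrib[where f="\<lambda>x. x * _"] cong: if_cong)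
      then show ?thesis by (simp add: vec_eq_iff)
    qed
    then have "det (mat (real m) :: real^'m^'m) * det Q = det P0 * det (\<chi> i j. real_of_int (Z $ i $ j))"
      by (metis det_mul)
    moreover have "det (mat (real m) :: real^'m^'m) = real m ^ CARD('m)"
      by (subst det_diagonal) (auto simp: mat_def)
    ultimately have "real m ^ CARD('m) * det Q = det P0 * det (\<chi> i j. real_of_int (Z $ i $ j))"
      by simp
    also have "det (\<chi> i j. real_of_int (Z $ i $ j)) = of_int (det Z)"
      by (simp add: det_def)
    finally have "\<bar>real m ^ CARD('m) * det Q\<bar> = \<bar>det P0 * of_int (det Z)\<bar>" by simp
    then have "real m ^ CARD('m) * \<bar>det Q\<bar> = \<bar>det P0\<bar> * real (nat \<bar>det Z\<bar>)"
      by (simp add: abs_mult)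
    then have "\<bar>det Q\<bar> = c * real (nat \<bar>det Z\<bar>)"
      using m(1) by (simp add: c_def field_simps)
    then show ?thesis by blast
  qed
  let ?S = "\<lambda>k. \<exists>Q. det Q \<noteq> 0 \<and> (\<forall>j. column j Q \<in> L) \<and> \<bar>det Q\<bar> = c * real k"
  have "\<exists>k. ?S k" using P0 ex[of P0] by blast
  then obtain k where k: "?S k" "\<And>k'. ?S k' \<Longrightarrow> k \<le> k'"
    using exists_least_iff[of ?S] by (metis not_le_imp_less)
  then obtain Q where Q: "det Q \<noteq> 0" "\<And>j. column j Q \<in> L" "\<bar>det Q\<bar> = c * real k" by blast
  have "\<exists>z::int^'m. v = Q *v (\<chi> i. of_int (z $ i))" if v: "v \<in> L" for v
  proof -
    obtain R where R: "\<And>v. Q *v (R *v v) = v" using det_nz_solve[OF Q(1)] by blast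
    define x where "x = R *v v"
    have xv: "Q *v x = v" by (simp add: x_def R)
    have "x $ j = of_int \<lfloor>x $ j\<rfloor>" for j
    proof (rule ccontr)
      assume nint: "x $ j \<noteq> of_int \<lfloor>x $ j\<rfloor>"
      define x' where "x' = x - of_int \<lfloor>x $ j\<rfloor> *\<^sub>R axis j 1"
      have xj: "x' $ j = frac (x $ j)" by (simp add: x'_def frac_def axis_def)
      have fr: "0 < frac (x $ j)" "frac (x $ j) < 1"
        using nint of_int_floor_le[of "x $ j"] frac_lt_1[of "x $ j"] by (auto simp: frac_def simp del: of_int_floor_le)
      have "Q *v x' = v - of_int \<lfloor>x $ j\<rfloor> *\<^sub>R column j Q"
        by (simp add: x'_def matrix_vector_mult_diff_distrib matrix_vector_mult_scaleR xv matrix_vector_mult_basis)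
      moreover have "of_int \<lfloor>x $ j\<rfloor> *\<^sub>R column j Q \<in> L"
        using subgroup_int_combination[OF zero sub, where I="{()}" and b="\<lambda>_. column j Q" and z="\<lambda>_. \<lfloor>x $ j\<rfloor>"] Q(2) by simp
      ultimately have inL: "Q *v x' \<in> L" using sub[OF v] by simp
      \<comment> \<open>Exchange column \<open>j\<close> for the vector whose \<open>j\<close>-th
        coordinate is the fractional part. By Cramer's rule the determinant is multiplied by that
        fraction, which lies strictly between 0 and 1.\<close>
      define Q' where "Q' = (\<chi> i l. if l = j then (Q *v x') $ i else Q $ i $ l)"
      have det': "det Q' = frac (x $ j) * det Q"
        unfolding Q'_def cramer_lemma xj ..
      have col': "column l Q' \<in> L" for l
      proof -
        have "column l Q' = (if l = j then Q *v x' else column l Q)"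
          by (simp add: Q'_def column_def vec_eq_iff)
        then show ?thesis using inL Q(2) by simp
      qed
      obtain k' where k': "\<bar>det Q'\<bar> = c * real k'" using ex[OF col'] by blast
      have "det Q' \<noteq> 0" using det' fr Q(1) by simp
      then have "k \<le> k'" using k(2) k' col' by blast
      then have "\<bar>det Q\<bar> \<le> \<bar>det Q'\<bar>" unfolding Q(3) k' using c by simp
      moreover have "\<bar>det Q'\<bar> = frac (x $ j) * \<bar>det Q\<bar>" using det' fr by (simp add: abs_mult)
      ultimately show False using fr Q(1) by (simp add: mult_le_cancel_right1)
    qed
    then have "x = (\<chi> i. of_int ((\<chi> i. \<lfloor>x $ i\<rfloor>) $ i))" by (simp add: vec_eq_iff)
    then show ?thesis using xv by metis
  qed
  then show ?thesis using that Q(1,2) by blast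
qed

text \<open>\<open>T\<close> maps the vectors of a lattice basis into \<open>L\<close>, hence to
  integer combinations of that basis.\<close>

lemma lattice_automorphism_integral:
  fixes L :: "(real^'m) set" and T :: "real^'m^'m"
  assumes "0 \<in> L" "\<And>x y. x \<in> L \<Longrightarrow> y \<in> L \<Longrightarrow> x - y \<in> L"
    and "e > 0" "\<And>x. x \<in> L \<Longrightarrow> norm x < e \<Longrightarrow> x = 0" "span L = UNIV"
    and T: "\<And>x. x \<in> L \<Longrightarrow> T *v x \<in> L"
  obtains P :: "real^'m^'m" and M :: "int^'m^'m" where "det P \<noteq> 0" "T ** P = P ** (\<chi> i j. of_int (M $ i $ j))"
proof -
  obtain P :: "real^'m^'m" where P: "det P \<noteq> 0" "\<And>j. column j P \<in> L"
    "\<And>v. v \<in> L \<Longrightarrow> \<exists>z::int^'m. v = P *v (\<chi> i. of_int (z $ i))"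
    using lattice_basis[OF assms(1-5)] by blast
  obtain z :: "'m \<Rightarrow> int^'m" where z: "\<And>j. T *v column j P = P *v (\<chi> i. of_int (z j $ i))"
    using P(3)[OF T[OF P(2)]] by metis
  have "(T ** P) $ i $ j = (P ** (\<chi> i j. of_int ((\<chi> i j. z j $ i) $ i $ j))) $ i $ j" for i j
    using arg_cong[OF z[of j], of "\<lambda>v. v $ i"]
    by (simp add: matrix_matrix_mult_def column_def matrix_vector_mult_def)
  then have "T ** P = P ** (\<chi> i j. of_int ((\<chi> i j. z j $ i) $ i $ j))" by (simp add: vec_eq_iff)
  with P(1) show ?thesis by (rule that)
qed

section \<open>Units whose conjugates have two moduli\<close>

lemma map_poly_of_int_mult: "map_poly (of_int :: int \<Rightarrow> 'a::comm_ring_1) (p * q) = map_poly of_int p * map_poly of_int q"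
  by (rule poly_eqI) (simp add: coeff_map_poly coeff_mult)

lemma map_poly_of_int_add: "map_poly (of_int :: int \<Rightarrow> 'a::comm_ring_1) (p + q) = map_poly of_int p + map_poly of_int q"
  by (rule poly_eqI) (simp add: coeff_map_poly)

lemma map_poly_of_int_sum: "map_poly (of_int :: int \<Rightarrow> 'a::comm_ring_1) (\<Sum>i\<in>I. f i) = (\<Sum>i\<in>I. map_poly of_int (f i))"
  by (rule poly_eqI) (simp add: coeff_map_poly coeff_sum)

text \<open>Take the primitive part of an integer polynomial of least degree vanishing at
  \<open>x\<close>. Pseudo-division gives divisibility up to an integer factor, which Gauss's lemma
  removes.\<close>

lemma minimal_integer_polynomial:
  fixes x :: real and w :: "int poly"
  assumes "w \<noteq> 0" "poly (map_poly of_int w) x = 0"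
  obtains q :: "int poly" where "q \<noteq> 0" "degree q \<le> degree w" "poly (map_poly of_int q) x = 0"
    "\<And>g :: int poly. poly (map_poly of_int g) x = 0 \<Longrightarrow> q dvd g"
proof -
  let ?P = "\<lambda>p::int poly. p \<noteq> 0 \<and> poly (map_poly of_int p) x = 0"
  obtain p where p: "?P p" and min: "\<And>r. ?P r \<Longrightarrow> degree p \<le> degree r"
    using exists_least_iff[of "\<lambda>k. \<exists>p. ?P p \<and> degree p = k"] assms by (metis not_le_imp_less)
  define q where "q = primitive_part p"
  have pq: "p = smult (content p) q" by (simp add: q_def)
  have c0: "content p \<noteq> 0" using p by simp
  have q0: "q \<noteq> 0" using p pq by auto
  have deg: "degree q = degree p" by (simp add: q_def)
  have "map_poly of_int p = smult (real_of_int (content p)) (map_poly of_int q)"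
    by (subst pq, rule poly_eqI) (simp add: coeff_map_poly)
  with p c0 have qx: "poly (map_poly of_int q) x = 0" by auto
  have prim: "content q = 1" using p by (simp add: q_def)
  show ?thesis
  proof (rule that[OF q0 _ qx])
    show "degree q \<le> degree w" using min[of w] assms deg by simp
    fix g :: "int poly" assume g: "poly (map_poly of_int g) x = 0"
    obtain a s where a: "a \<noteq> 0" and as: "smult a g = q * s + pseudo_mod g q"
      using pseudo_mod(1)[OF q0] by blast
    define r where "r = pseudo_mod g q"
    have "poly (map_poly of_int (smult a g)) x = real_of_int a * poly (map_poly of_int g) x"
      by (subst map_poly_smult) auto
    with g as have "poly (map_poly of_int r) x = 0"
      by (simp add: r_def map_poly_of_int_mult map_poly_of_int_add qx)
    with min[of r] deg pseudo_mod(2)[OF q0, of g] have "r = 0"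
      by (force simp: r_def)
    with as have eq: "smult a g = q * s" by (simp add: r_def)
    \<comment> \<open>Since \<open>q\<close> is primitive, \<open>s\<close> absorbs the whole
      content, so \<open>a\<close> divides \<open>s\<close> and can be cancelled.\<close>
    have "content (smult a g) = content s"
      unfolding eq by (simp add: content_mult prim)
    then have "\<bar>a\<bar> * content g = content s" by simp
    then have "a dvd content s" by (metis abs_dvd_iff dvd_triv_left)
    then have "[:a:] dvd s" by (simp add: const_poly_dvd_iff_dvd_content)
    then obtain s' where "s = smult a s'" by (auto elim!: dvdE)
    with eq a have "smult a g = smult a (q * s')" by simp
    then have "smult a (g - q * s') = 0" by (simp add: smult_diff_right)
    with a have "g = q * s'" by simp
    then show "q dvd g" by simp
  qed
qed

text \<open>The moduli of the roots multiply to 1. If \<open>a\<close> roots have log-modulus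
  \<open>L\<close> and \<open>b\<close> have \<open>- L / n\<close>, taking logarithms gives b = n
  a, so the degree is (n + 1) a with a > 0.\<close>

lemma degree_of_unit_with_two_moduli:
  fixes q :: "int poly" and x L :: real
  assumes "q \<noteq> 0" "poly (map_poly of_int q) x = 0" "n > 0" "L \<noteq> 0"
    and lc: "\<bar>lead_coeff q\<bar> = 1" and c0: "\<bar>coeff q 0\<bar> = 1"
    and roots: "\<And>z::complex. poly (map_poly of_int q) z = 0 \<Longrightarrow>
        ln (norm z) = L \<or> ln (norm z) = - L / real n"
  shows "degree q \<ge> n + 1"
proof -
  define Q where "Q = (map_poly of_int q :: complex poly)"
  have lcQ: "norm (lead_coeff Q) = 1"
    using lc by (simp add: Q_def degree_map_poly coeff_map_poly flip: of_int_abs)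
  have Q0: "norm (coeff Q 0) = 1"
    using c0 by (simp add: Q_def degree_map_poly coeff_map_poly flip: of_int_abs)
  have degQ: "degree Q = degree q" by (simp add: Q_def degree_map_poly)
  have "Q \<noteq> 0" using lcQ by auto
  then obtain A where A: "size A = degree Q" "Q = smult (lead_coeff Q) (\<Prod>z\<in>#A. [:- z, 1:])"
    using alg_closed_imp_factorization by blast
  have "poly (\<Prod>z\<in>#A. [:- z, 1:]) 0 = (\<Prod>z\<in>#A. - z)"
    by (induction A) auto
  moreover have "norm (\<Prod>z\<in>#A. - z) = (\<Prod>z\<in>#A. norm z)"
    by (induction A) (auto simp: norm_mult)
  moreover have "coeff Q 0 = lead_coeff Q * poly (\<Prod>z\<in>#A. [:- z, 1:]) 0"
    by (subst A(2)) (simp add: poly_0_coeff_0)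
  ultimately have prod1: "(\<Prod>z\<in>#A. norm z) = 1"
    using lcQ Q0 by (simp add: norm_mult)
  have "poly Q z = 0" if "z \<in># A" for z
    using that by (subst A(2)) (auto simp: poly_prod_mset prod_mset_zero_iff)
  then have rA: "ln (norm z) = L \<or> ln (norm z) = - L / real n" if "z \<in># A" for z
    using roots that by (simp add: Q_def)
  \<comment> \<open>\<open>ln 0\<close> is 0, which differs from both admissible values because
    \<open>L\<close> is nonzero.\<close>
  have nz: "z \<noteq> 0" if "z \<in># A" for z
    using rA[OF that] assms by auto
  define a where "a = size (filter_mset (\<lambda>z. ln (norm z) = L) A)"
  define b where "b = size (filter_mset (\<lambda>z. ln (norm z) \<noteq> L) A)"
  have "ln (\<Prod>z\<in>#A. norm z) = (\<Sum>z\<in>#A. ln (norm z))"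
    using nz
  proof (induction A)
    case (add y A)
    have "(\<Prod>z\<in>#A. norm z) > 0" using add.prems by (induction A) (auto intro!: mult_pos_pos)
    then have "ln (norm y * (\<Prod>z\<in>#A. norm z)) = ln (norm y) + ln (\<Prod>z\<in>#A. norm z)"
      using add.prems[of y] by (intro ln_mult_pos) auto
    with add show ?case by simp
  qed auto
  also have "\<dots> = L * a - L * b / real n"
    unfolding a_def b_def using rA
  proof (induction A)
    case (add y A)
    have "ln (norm y) = L \<or> ln (norm y) = - L / real n" using add.prems[of y] by simp
    then show ?case using add by (elim disjE) (auto simp: algebra_simps add_divide_distrib)
  qed auto
  finally have "L * (real a - real b / real n) = 0"
    using prod1 by (simp add: algebra_simps)
  with assms have b: "b = n * a" by (simp add: field_simps flip: of_nat_mult)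
  have ab: "a + b = degree q"
    unfolding a_def b_def using A(1) degQ
    by (metis size_union multiset_partition)
  have "degree q \<noteq> 0"
  proof
    assume "degree q = 0"
    then obtain c where "q = [:c:]" using degree_eq_zeroE by blast
    with assms show False by (simp add: map_poly_pCons)
  qed
  with ab b have "a \<ge> 1" by (cases a) auto
  moreover from this have "n * 1 \<le> n * a" by (rule mult_le_mono2)
  ultimately show ?thesis using ab b by linarith
qed

text \<open>The arithmetic core. \<open>D\<close> satisfies the polynomial \<open>w\<close> of
  degree at most 2n read off from \<open>funct\<close>, whereas its two-moduli conjugates would
  force degree at least 2n + 1 if \<open>D\<close> were not 1. So \<open>w\<close> vanishes
  identically.\<close>

lemma integer_reciprocal_polynomial_trivial:
  fixes F :: "int poly" and D :: real and n :: nat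
  assumes n: "n \<ge> 2" and D: "D > 0"
    and deg: "degree F = 2 * n + 1" and lc: "coeff F (2 * n + 1) = 1" and c0: "coeff F 0 = -1"
    and root: "poly (map_poly of_int F) ((1 / D) ^ n) = 0"
    and roots: "\<And>z::complex. poly (map_poly of_int F) z = 0 \<Longrightarrow> norm z = (1 / D) ^ n \<or> norm z = sqrt D"
    and funct: "\<And>x. x \<noteq> 0 \<Longrightarrow> (x - (1 / D) ^ n) * (x ^ (2 * n + 1) * poly (map_poly of_int F) (D / x))
        = (D ^ (n + 1) - x) * poly (map_poly of_int F) x"
  shows "D = 1"
proof (rule ccontr)
  assume D1: "D \<noteq> 1"
  define N where "N = 2 * n + 1"
  define f where "f k = coeff F k" for k
  define lam where "lam = (1 / D) ^ n"
  define Fr where "Fr = (map_poly of_int F :: real poly)"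
  have Frc: "coeff Fr k = real_of_int (f k)" for k by (simp add: Fr_def f_def coeff_map_poly)
  have degFr: "degree Fr = N" by (simp add: Fr_def N_def deg degree_map_poly)
  \<comment> \<open>The polynomial x^N F(D / x).\<close>
  define H where "H = (\<Sum>k\<le>N. monom (real_of_int (f k) * D ^ k) (N - k))"
  have Hc: "coeff H j = real_of_int (f (N - j)) * D ^ (N - j)" if "j \<le> N" for j
  proof -
    have "coeff H j = (\<Sum>k\<le>N. if k = N - j then real_of_int (f k) * D ^ k else 0)"
      unfolding H_def coeff_sum by (intro sum.cong) (use that in auto)
    then show ?thesis by simp
  qed
  have Hx: "poly H x = x ^ N * poly Fr (D / x)" if "x \<noteq> 0" for x
    unfolding H_def poly_sum poly_altdef[of Fr] degFr sum_distrib_left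
    by (intro sum.cong) (use that in \<open>auto simp: poly_monom Frc power_divide power_diff\<close>)
  \<comment> \<open>\<open>funct\<close> says nothing at 0; the extra factor x makes both sides
    agree there as well, and is then cancelled.\<close>
  have "[:0, 1:] * ([:- lam, 1:] * H) = [:0, 1:] * ([:D ^ (n + 1), -1:] * Fr)"
  proof (rule poly_eq_poly_eq_iff[THEN iffD1], rule ext)
    fix x
    show "poly ([:0, 1:] * ([:- lam, 1:] * H)) x = poly ([:0, 1:] * ([:D ^ (n + 1), -1:] * Fr)) x"
    proof (cases "x = 0")
      case False
      then have "(x - lam) * poly H x = (D ^ (n + 1) - x) * poly Fr x"
        using Hx[of x] funct[of x] by (simp add: Fr_def N_def lam_def)
      moreover have "poly [:- lam, 1:] x = x - lam" "poly [:D ^ (n + 1), -1:] x = D ^ (n + 1) - x"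
        by simp_all
      ultimately show ?thesis by (simp only: poly_mult)
    qed simp
  qed
  then have eq: "[:- lam, 1:] * H = [:D ^ (n + 1), -1:] * Fr"
    using mult_left_cancel[of "[:0, 1:] :: real poly"] by (simp only: pCons_eq_0_iff) simp
  have co: "- lam * coeff H (Suc j) + coeff H j = D ^ (n + 1) * f (Suc j) - f j" for j
    using arg_cong[OF eq, of "\<lambda>p. coeff p (Suc j)"] by (simp add: Frc)
  have lamD: "lam * D ^ (n + k) = D ^ k" for k
    using D by (simp add: lam_def power_add power_divide)
  \<comment> \<open>The coefficient of x in \<open>eq\<close>, with \<open>lam\<close> eliminated by
    \<open>lamD\<close>; \<open>E2\<close> is the coefficient of x^2.\<close>
  have E1: "D ^ N - f (2 * n) * D ^ n - f 1 * D ^ (n + 1) - 1 = 0"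
  proof -
    have "- lam * (f (2 * n) * D ^ (n + n)) + D ^ N = D ^ (n + 1) * f 1 + 1"
      using co[of 0] lc c0 by (simp add: Hc N_def f_def mult_2)
    moreover have "lam * (f (2 * n) * D ^ (n + n)) = f (2 * n) * D ^ n"
      using lamD[of n] by simp
    ultimately show ?thesis by (simp add: algebra_simps)
  qed
  have E2: "f (2 * n) * D ^ (2 * n) - f 2 * D ^ (n + 1) - f (2 * n - 1) * D ^ (n - 1) + f 1 = 0"
  proof -
    have "- lam * (f (2 * n - 1) * D ^ (n + (n - 1))) + f (2 * n) * D ^ (2 * n) = D ^ (n + 1) * f 2 - f 1"
      using co[of 1] n by (simp add: Hc N_def mult_2 numeral_2_eq_2)
    moreover have "lam * (f (2 * n - 1) * D ^ (n + (n - 1))) = f (2 * n - 1) * D ^ (n - 1)"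
      using lamD[of "n - 1"] by simp
    ultimately show ?thesis by (simp add: algebra_simps)
  qed
  define w where "w = monom (f (2 * n)) (2 * n) - monom (f 2) (n + 1) - monom (f (2 * n - 1)) (n - 1) + monom (f 1) 0"
  have "w = 0"
  proof (rule ccontr)
    assume w0: "w \<noteq> 0"
    have wr: "(map_poly of_int w :: real poly) = monom (f (2 * n)) (2 * n) - monom (f 2) (n + 1) - monom (f (2 * n - 1)) (n - 1) + monom (f 1) 0"
      unfolding w_def by (rule poly_eqI) (simp add: coeff_map_poly)
    have "poly (map_poly of_int w) D = 0"
      unfolding wr using E2 by (simp add: poly_monom)
    then obtain q where q: "q \<noteq> 0" "degree q \<le> degree w" "poly (map_poly of_int q) D = 0"
      "\<And>g :: int poly. poly (map_poly of_int g) D = 0 \<Longrightarrow> q dvd g"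
      using minimal_integer_polynomial[OF w0] by metis
    \<comment> \<open>The polynomial x^(nN) F(x^(-n)). It vanishes at \<open>D\<close>, so every
      root of \<open>q\<close> is a root of \<open>g\<close>, which controls its modulus.\<close>
    define g where "g = (\<Sum>k\<le>N. monom (f k) (n * (N - k)))"
    have gz: "poly (map_poly of_int g) z = z ^ (n * N) * poly (map_poly of_int F) ((1 / z) ^ n)"
      if "z \<noteq> 0" for z :: "'a::field_char_0"
    proof -
      have "poly (map_poly of_int g) z = (\<Sum>k\<le>N. of_int (f k) * z ^ (n * (N - k)))"
        unfolding g_def map_poly_of_int_sum poly_sum by (simp add: map_poly_monom poly_monom)
      also have "\<dots> = (\<Sum>k\<le>N. z ^ (n * N) * (of_int (f k) * ((1 / z) ^ n) ^ k))"
        using that by (intro sum.cong) (auto simp: power_divide power_diff diff_mult_distrib2 power_mult)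
      finally show ?thesis
        unfolding poly_altdef[of "map_poly of_int F"] sum_distrib_left f_def N_def
        by (simp add: degree_map_poly deg coeff_map_poly)
    qed
    have "q dvd g" using q(4)[of g] gz[of D] root D by simp
    then obtain s where s: "g = q * s" by blast
    \<comment> \<open>The extreme coefficients of \<open>g\<close> are 1 and -1. Those of its
      divisor \<open>q\<close> are therefore units, which is what makes \<open>D\<close> an
      algebraic unit.\<close>
    have g0: "coeff g 0 = 1"
    proof -
      have "coeff g 0 = (\<Sum>k\<le>N. if k = N then f k else 0)"
        unfolding g_def coeff_sum using n by (intro sum.cong) auto
      then show ?thesis using lc by (simp add: N_def f_def)
    qed
    have gN: "coeff g (n * N) = -1"
    proof -
      have "coeff g (n * N) = (\<Sum>k\<le>N. if k = 0 then f k else 0)"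
        unfolding g_def coeff_sum using n by (intro sum.cong) auto
      then show ?thesis using c0 by (simp add: f_def)
    qed
    have "degree g \<le> n * N"
      unfolding g_def by (intro degree_sum_le) (auto intro: order.trans[OF degree_monom_le])
    moreover have "degree g \<ge> n * N" using gN by (intro le_degree) auto
    ultimately have "lead_coeff g = -1" using gN by simp
    then have "lead_coeff q * lead_coeff s = -1" by (simp add: s lead_coeff_mult)
    then have "lead_coeff q dvd 1" by (intro dvdI[of _ _ "- lead_coeff s"]) simp
    then have ql: "\<bar>lead_coeff q\<bar> = 1" by simp
    have "coeff q 0 * coeff s 0 = 1" using g0 by (simp add: s coeff_mult)
    then have "coeff q 0 dvd 1" by (metis dvd_triv_left)
    then have qc: "\<bar>coeff q 0\<bar> = 1" by simp
    \<comment> \<open>The degree bound is used with 2n in place of n: a root has modulus D or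
      D^(-1/(2n)).\<close>
    have "degree q \<ge> 2 * n + 1"
    proof (rule degree_of_unit_with_two_moduli[OF q(1,3) _ _ ql qc])
      show "2 * n > 0" "ln D \<noteq> 0" using n D D1 by auto
      fix z :: complex assume z: "poly (map_poly of_int q) z = 0"
      have z0: "z \<noteq> 0"
      proof
        assume "z = 0"
        with z have "coeff q 0 = 0" by (simp add: poly_0_coeff_0 coeff_map_poly)
        with qc show False by simp
      qed
      have "poly (map_poly of_int g) z = 0" by (simp add: s map_poly_of_int_mult z)
      then have "norm ((1 / z) ^ n) = (1 / D) ^ n \<or> norm ((1 / z) ^ n) = sqrt D"
        using gz[OF z0] z0 by (intro roots) simp
      then have "ln ((1 / norm z) ^ n) = ln ((1 / D) ^ n) \<or> ln ((1 / norm z) ^ n) = ln (sqrt D)"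
        by (auto simp: norm_power norm_divide)
      then have "real n * ln (norm z) = real n * ln D \<or> real n * ln (norm z) = - ln D / 2"
        using z0 D by (auto simp: ln_realpow ln_div ln_sqrt)
      then show "ln (norm z) = ln D \<or> ln (norm z) = - ln D / real (2 * n)"
        using n by (auto simp: field_simps)
    qed
    moreover have "degree w \<le> 2 * n"
      unfolding w_def using n
      by (intro degree_add_le degree_diff_le) (auto intro: order.trans[OF degree_monom_le])
    ultimately show False using q(2) by simp
  qed
  \<comment> \<open>For n at least 2 the exponents 0, n - 1, n + 1 and 2n are distinct, so no
    cancellation between the monomials can occur.\<close>
  then have "coeff w 0 = 0" "coeff w (2 * n) = 0" by auto
  then have "f 1 = 0" "f (2 * n) = 0"
    using n by (auto simp: w_def split: if_splits)
  with E1 have "D ^ N = 1" by simp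
  with D D1 show False
    using power_eq_imp_eq_base[of D N 1] by (simp add: N_def)
qed

section \<open>Integral characteristic polynomials\<close>

text \<open>Apply the homomorphism to the Leibniz formula. It is used both for evaluation of integer
  polynomials and for the embedding of the reals.\<close>

lemma det_ring_hom:
  fixes h :: "'a::comm_ring_1 \<Rightarrow> 'b::comm_ring_1" and A :: "'a^'m^'m"
  assumes add: "\<And>x y. h (x + y) = h x + h y" and mult: "\<And>x y. h (x * y) = h x * h y" and one: "h 1 = 1"
  shows "h (det A) = det (\<chi> i j. h (A $ i $ j))"
proof -
  have zero: "h 0 = 0" using add[of 0 0] by simp
  have uminus: "h (- x) = - h x" for x using add[of x "- x"] zero by (simp add: eq_neg_iff_add_eq_0 add.commute)
  have sum: "h (sum f I) = (\<Sum>i\<in>I. h (f i))" for f :: "('m \<Rightarrow> 'm) \<Rightarrow> 'a" and I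
    by (induction I rule: infinite_finite_induct) (auto simp: zero add)
  have prod: "h (prod f I) = (\<Prod>i\<in>I. h (f i))" for f :: "'m \<Rightarrow> 'a" and I
    by (induction I rule: infinite_finite_induct) (auto simp: one mult)
  have sgn: "h (of_int (sign p)) = of_int (sign p)" for p :: "'m \<Rightarrow> 'm"
    by (simp add: sign_def one uminus)
  show ?thesis by (simp add: det_def sum mult prod sgn)
qed

lemma coeff_prod_linear:
  fixes c d :: "'i \<Rightarrow> 'a::comm_ring_1"
  assumes "finite S"
  shows "degree (\<Prod>i\<in>S. [:c i, d i:]) \<le> card S \<and> coeff (\<Prod>i\<in>S. [:c i, d i:]) (card S) = prod d S"
  using assms
proof (induction S)
  case (insert a S)
  let ?P = "\<Prod>i\<in>S. [:c i, d i:]"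
  have "degree ([:c a, d a:] * ?P) \<le> 1 + card S"
    using insert by (intro order.trans[OF degree_mult_le] add_mono) auto
  moreover have "coeff ?P (Suc (card S)) = 0"
    using insert by (intro coeff_eq_0) auto
  ultimately show ?case using insert by simp
qed simp

text \<open>The determinant of X - M over the integer polynomials: integrality is built in, and real
  and complex evaluations share one polynomial.\<close>

definition int_charpoly :: "int^'m^'m \<Rightarrow> int poly" where
  "int_charpoly M = det (\<chi> i j. [:- (M $ i $ j), if i = j then 1 else 0:])"

lemma poly_int_charpoly:
  "poly (map_poly of_int (int_charpoly M)) z =
   det (\<chi> i j. (if i = j then z else 0) - of_int (M $ i $ j))"
  for z :: "'a::comm_ring_1"
proof -
  have "poly (map_poly of_int (int_charpoly M)) z =
      det (\<chi> i j. poly (map_poly of_int ((\<chi> i j. [:- (M $ i $ j), if i = j then 1 else 0:]) $ i $ j)) z)"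
    unfolding int_charpoly_def
    by (rule det_ring_hom) (auto simp: map_poly_of_int_add map_poly_of_int_mult)
  also have "\<dots> = det (\<chi> i j. (if i = j then z else 0) - of_int (M $ i $ j))"
    by (rule arg_cong[where f=det]) (auto simp: vec_eq_iff map_poly_pCons)
  finally show ?thesis .
qed

lemma int_charpoly_monic:
  fixes M :: "int^'m^'m"
  shows "degree (int_charpoly M) = CARD('m)" "coeff (int_charpoly M) CARD('m) = 1"
proof -
  let ?t = "\<lambda>p i. [:- (M $ i $ p i), if i = p i then 1 else 0:]"
  have exp: "int_charpoly M = (\<Sum>p | p permutes UNIV. of_int (sign p) * (\<Prod>i\<in>UNIV. ?t p i))"
    by (simp add: int_charpoly_def det_def)
  have P: "degree (\<Prod>i\<in>UNIV. ?t p i) \<le> CARD('m)"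
    "coeff (\<Prod>i\<in>UNIV. ?t p i) CARD('m) = (\<Prod>i\<in>UNIV. if i = p i then 1 else 0)" for p
    using coeff_prod_linear[of UNIV "\<lambda>i. - (M $ i $ p i)" "\<lambda>i. if i = p i then 1 else 0"] by auto
  have "coeff (int_charpoly M) CARD('m) =
      (\<Sum>p | p permutes (UNIV :: 'm set). of_int (sign p) * (\<Prod>i\<in>UNIV. if i = p i then 1 else 0))"
    unfolding exp coeff_sum by (intro sum.cong) (auto simp: P of_int_poly)
  \<comment> \<open>The surviving Leibniz sum is that of the identity matrix.\<close>
  also have "\<dots> = det (mat 1 :: int^'m^'m)"
    by (simp add: det_def mat_def)
  finally show 1: "coeff (int_charpoly M) CARD('m) = 1" by simp
  have "degree (int_charpoly M) \<le> CARD('m)"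
    unfolding exp
    by (intro degree_sum_le) (auto simp: of_int_poly intro!: order.trans[OF degree_smult_le] P)
  moreover have "degree (int_charpoly M) \<ge> CARD('m)"
    using 1 by (intro le_degree) auto
  ultimately show "degree (int_charpoly M) = CARD('m)" by simp
qed

text \<open>\<open>P\<close> conjugates z - M into z - T. The field is left general because both
  real and complex \<open>z\<close> occur later.\<close>

lemma poly_int_charpoly_similar:
  fixes M :: "int^'m^'m" and T P :: "real^'m^'m" and z :: "'a::real_field"
  assumes P: "det P \<noteq> 0" and TP: "T ** P = P ** (\<chi> i j. of_int (M $ i $ j))"
  shows "poly (map_poly of_int (int_charpoly M)) z = det (\<chi> i j. (if i = j then z else 0) - of_real (T $ i $ j))"
proof -
  let ?c = "\<lambda>X::real^'m^'m. (\<chi> i j. of_real (X $ i $ j)) :: 'a^'m^'m"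
  let ?M = "(\<chi> i j. of_int (M $ i $ j)) :: 'a^'m^'m"
  have cm: "?c (X ** Y) = ?c X ** ?c Y" for X Y
    by (simp add: vec_eq_iff matrix_matrix_mult_def)
  have TP': "?c T ** ?c P = ?c P ** ?M"
    using arg_cong[OF TP, of ?c] by (simp add: cm)
  have cP: "det (?c P) \<noteq> 0"
    using det_ring_hom[of "of_real :: real \<Rightarrow> 'a" P] P by (metis of_real_1 of_real_add of_real_eq_0_iff of_real_mult)
  have sub: "(\<chi> i j. (if i = j then z else 0) - X $ i $ j) = mat z - X" for X :: "'a^'m^'m"
    by (simp add: vec_eq_iff mat_def)
  have "(mat z - ?c T) ** ?c P = ?c P ** (mat z - ?M)"
  proof -
    have "mat z ** ?c P = ?c P ** mat z"
      by (simp add: vec_eq_iff matrix_matrix_mult_def mat_def if_distrib[where f="\<lambda>x. _ * x"]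
          if_distrib[where f="\<lambda>x. x * _"] mult.commute cong: if_cong)
    then show ?thesis using TP' by (simp add: matrix_mul_diff)
  qed
  then have "det (mat z - ?c T) * det (?c P) = det (?c P) * det (mat z - ?M)"
    by (metis det_mul)
  with cP have "det (mat z - ?M) = det (mat z - ?c T)" by simp
  then show ?thesis
    unfolding poly_int_charpoly using sub[of ?M] sub[of "?c T"] by simp
qed

section \<open>Spectrum of conformal block matrices\<close>

lemma sum_UNIV_Plus: "(\<Sum>i\<in>UNIV. g i) = (\<Sum>i\<in>UNIV. g (Inl i)) + (\<Sum>i\<in>UNIV. g (Inr i))"
  for g :: "'a::finite + 'b::finite \<Rightarrow> 'c::comm_monoid_add"
  by (simp add: UNIV_Plus_UNIV[symmetric] sum.Plus del: UNIV_Plus_UNIV)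

lemma prod_UNIV_Plus: "(\<Prod>i\<in>UNIV. g i) = (\<Prod>i\<in>UNIV. g (Inl i)) * (\<Prod>i\<in>UNIV. g (Inr i))"
  for g :: "'a::finite + 'b::finite \<Rightarrow> 'c::comm_monoid_mult"
  by (simp add: UNIV_Plus_UNIV[symmetric] prod.Plus del: UNIV_Plus_UNIV)

text \<open>An eigenvector with nonzero first coordinate has eigenvalue \<open>l\<close>. Otherwise
  it lives in the second block, where \<open>T\<close> scales squared norms by
  \<open>D\<close>.\<close>

lemma eigenvalue_modulus:
  fixes T :: "real^(unit + 'k::finite)^(unit + 'k)" and z :: complex
  assumes TT: "transpose T ** T = (\<chi> i j. if i = j then (case i of Inl _ \<Rightarrow> l\<^sup>2 | Inr _ \<Rightarrow> D) else 0)"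
    and T0: "T $ Inl () $ Inl () = l" "\<And>b. T $ Inl () $ Inr b = 0"
    and "l > 0" "D > 0"
    and det: "det (\<chi> i j. (if i = j then z else 0) - complex_of_real (T $ i $ j)) = 0"
  shows "norm z = l \<or> norm z = sqrt D"
proof -
  let ?A = "(\<chi> i j. (if i = j then z else 0) - complex_of_real (T $ i $ j))"
  have "\<not> invertible ?A" using det invertible_det_nz by blast
  then obtain w where w: "?A *v w = 0" "w \<noteq> 0"
    using matrix_left_invertible_ker[of ?A] matrix_left_right_inverse[of _ ?A] unfolding invertible_def by blast
  have ev: "(\<Sum>j\<in>UNIV. complex_of_real (T $ i $ j) * w $ j) = z * w $ i" for i
  proof -
    have "0 = (?A *v w) $ i" using w by simp
    also have "\<dots> = (\<Sum>j\<in>UNIV. (if i = j then z * w $ j else 0) - complex_of_real (T $ i $ j) * w $ j)"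
      unfolding matrix_vector_mult_def by (auto intro!: sum.cong simp: algebra_simps)
    finally show ?thesis by (simp add: sum_subtractf)
  qed
  show ?thesis
  proof (cases "w $ Inl () = 0")
    case False
    have "of_real l * w $ Inl () = z * w $ Inl ()"
      using ev[of "Inl ()"] by (simp add: sum_UNIV_Plus T0 UNIV_unit)
    with False \<open>l > 0\<close> show ?thesis by auto
  next
    case True
    \<comment> \<open>\<open>T\<close> is real, so the norm identity is applied to the real and
      imaginary parts of \<open>w\<close> separately and then added.\<close>
    let ?u = "\<chi> i. Re (w $ i)" and ?v = "\<chi> i. Im (w $ i)"
    have N: "(norm (T *v x))\<^sup>2 = (\<Sum>i\<in>UNIV. (case i of Inl _ \<Rightarrow> l\<^sup>2 | Inr _ \<Rightarrow> D) * (x $ i)\<^sup>2)" for x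
    proof -
      have "(norm (T *v x))\<^sup>2 = x \<bullet> ((transpose T ** T) *v x)"
        by (metis dot_lmul_matrix matrix_vector_mul_assoc power2_norm_eq_inner transpose_matrix_vector inner_commute)
      also have "(transpose T ** T) *v x = (\<chi> i. (case i of Inl _ \<Rightarrow> l\<^sup>2 | Inr _ \<Rightarrow> D) * x $ i)"
        unfolding TT matrix_vector_mult_def
        by (simp add: vec_eq_iff if_distrib[where f="\<lambda>x. x * _"] cong: if_cong)
      also have "x \<bullet> \<dots> = (\<Sum>i\<in>UNIV. (case i of Inl _ \<Rightarrow> l\<^sup>2 | Inr _ \<Rightarrow> D) * (x $ i)\<^sup>2)"
        by (simp add: inner_vec_def power2_eq_square mult.left_commute)
      finally show ?thesis .
    qed
    have Tu: "(T *v ?u) $ i = Re (z * w $ i)" and Tv: "(T *v ?v) $ i = Im (z * w $ i)" for i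
      unfolding ev[symmetric] by (simp_all add: matrix_vector_mult_def)
    have "(norm (T *v ?u))\<^sup>2 + (norm (T *v ?v))\<^sup>2 = (\<Sum>i\<in>UNIV. (norm (z * w $ i))\<^sup>2)"
      unfolding power2_norm_eq_inner inner_vec_def Tu Tv
      by (simp add: sum.distrib[symmetric] power2_norm_eq_inner inner_complex_def del: complex_inner_1)
    also have "\<dots> = (norm z)\<^sup>2 * (\<Sum>i\<in>UNIV. (norm (w $ i))\<^sup>2)"
      by (simp add: norm_mult power_mult_distrib sum_distrib_left)
    finally have A: "(norm (T *v ?u))\<^sup>2 + (norm (T *v ?v))\<^sup>2 = (norm z)\<^sup>2 * (\<Sum>i\<in>UNIV. (norm (w $ i))\<^sup>2)" .
    have "(norm (T *v ?u))\<^sup>2 + (norm (T *v ?v))\<^sup>2 = (\<Sum>i\<in>UNIV. (case i of Inl _ \<Rightarrow> l\<^sup>2 | Inr _ \<Rightarrow> D) * (norm (w $ i))\<^sup>2)"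
      unfolding N by (simp add: sum.distrib[symmetric] cmod_power2 distrib_left)
    also have "\<dots> = D * (\<Sum>i\<in>UNIV. (norm (w $ i))\<^sup>2)"
      by (simp add: sum_UNIV_Plus UNIV_unit True sum_distrib_left)
    finally have eq: "(norm z)\<^sup>2 * (\<Sum>i\<in>UNIV. (norm (w $ i))\<^sup>2) = D * (\<Sum>i\<in>UNIV. (norm (w $ i))\<^sup>2)"
      using A by simp
    have "(\<Sum>i\<in>UNIV. (norm (w $ i))\<^sup>2) \<noteq> 0"
      using \<open>w \<noteq> 0\<close> by (simp add: sum_nonneg_eq_0_iff vec_eq_iff)
    with eq have "(norm z)\<^sup>2 = D" by simp
    then show ?thesis by (metis norm_ge_zero real_sqrt_unique)
  qed
qed

text \<open>Let S be the lower block of \<open>T\<close>. From S S^T = D follows D - x S = S (S^T -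
  x); determinants, with det S = 1 / l and even size, relate the characteristic polynomial of S at D
  / x to that at x. The factor y - l of \<open>f y\<close> accounts for the rest.\<close>

lemma charpoly_functional_equation:
  fixes T :: "real^(unit + 'k::finite)^(unit + 'k)" and x :: real
  defines "f \<equiv> \<lambda>x. det (\<chi> i j. (if i = j then x else 0) - T $ i $ j)"
  assumes TT: "T ** transpose T = (\<chi> i j. if i = j then (case i of Inl _ \<Rightarrow> l\<^sup>2 | Inr _ \<Rightarrow> D) else 0)"
    and T0: "T $ Inl () $ Inl () = l" "\<And>b. T $ Inl () $ Inr b = 0" "\<And>b. T $ Inr b $ Inl () = 0"
    and l: "l > 0" and D: "D > 0" and ev: "even CARD('k)" and det1: "det T = 1" and x: "x \<noteq> 0"
  shows "(x - l) * (x ^ (CARD('k) + 1) * f (D / x)) = (D / l - x) * f x" "f l = 0"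
proof -
  \<comment> \<open>\<open>U a b\<close> is the block matrix of 1 and a - b S; multiplying by
    \<open>V a b\<close> scales the rows of the two blocks.\<close>
  define U :: "real \<Rightarrow> real \<Rightarrow> real^(unit + 'k)^(unit + 'k)" where
    "U a b = (\<chi> i j. case (i, j) of (Inl _, Inl _) \<Rightarrow> 1
       | (Inr p, Inr q) \<Rightarrow> (if p = q then a else 0) - b * T $ Inr p $ Inr q | _ \<Rightarrow> 0)" for a b
  define V :: "real \<Rightarrow> real \<Rightarrow> real^(unit + 'k)^(unit + 'k)" where
    "V a b = (\<chi> i j. if i = j then (case i of Inl _ \<Rightarrow> a | Inr _ \<Rightarrow> b) else 0)" for a b
  have detV: "det (V a b) = a * b ^ CARD('k)" for a b
    by (subst det_diagonal) (auto simp: V_def prod_UNIV_Plus UNIV_unit)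
  have VX: "(V a b ** X) $ i $ j = (case i of Inl _ \<Rightarrow> a | Inr _ \<Rightarrow> b) * X $ i $ j" for a b X i j
    by (simp add: V_def matrix_matrix_mult_def if_distrib[where f="\<lambda>x. x * _"] cong: if_cong)
  have fU: "f y = (y - l) * det (U y 1)" for y
  proof -
    have "(\<chi> i j. (if i = j then y else 0) - T $ i $ j) = V (y - l) 1 ** U y 1"
      unfolding vec_eq_iff VX by (auto simp: U_def T0 split: sum.splits)
    then show ?thesis by (simp add: f_def det_mul detV)
  qed
  show "f l = 0" by (simp add: fU)
  have "U D x = V 1 x ** U (D / x) 1"
    unfolding vec_eq_iff VX using x by (auto simp: U_def T0 algebra_simps split: sum.splits)
  then have 1: "det (U D x) = x ^ CARD('k) * det (U (D / x) 1)" by (simp add: det_mul detV)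
  have "U (- x) (- 1) = V 1 (-1) ** U x 1"
    unfolding vec_eq_iff VX by (auto simp: U_def T0 algebra_simps split: sum.splits)
  then have 2: "det (U (- x) (- 1)) = det (U x 1)" using ev by (simp add: det_mul detV)
  have "T = V l 1 ** U 0 (- 1)"
    unfolding vec_eq_iff VX by (auto simp: U_def T0 algebra_simps split: sum.splits)
  then have 3: "det (U 0 (- 1)) = 1 / l" using det1 l by (metis detV det_mul mult.right_neutral nonzero_eq_divide_eq mult.commute power_one less_irrefl)
  have S: "(\<Sum>q\<in>UNIV. T $ Inr p $ Inr q * T $ Inr p' $ Inr q) = (if p = p' then D else 0)" for p p'
    using arg_cong[OF TT, of "\<lambda>X. X $ Inr p $ Inr p'"]
    by (simp add: matrix_matrix_mult_def transpose_def sum_UNIV_Plus T0 UNIV_unit split: if_splits)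
  \<comment> \<open>The factorisation D - x S = S (S^T - x), padded with 1 in the first
    block.\<close>
  have "U D x = U 0 (- 1) ** transpose (U (- x) (- 1))"
    unfolding vec_eq_iff matrix_matrix_mult_def
    by (auto simp: U_def transpose_def sum_UNIV_Plus UNIV_unit distrib_left sum.distrib S
        if_distrib[where f="\<lambda>x. _ * x"] algebra_simps sum_negf split: sum.splits cong: if_cong)
  then have 4: "det (U D x) = det (U x 1) / l" by (simp add: det_mul 2 3)
  have "x * f (D / x) = (D - l * x) * det (U (D / x) 1)"
    using x by (simp add: fU field_simps)
  then have "x ^ (CARD('k) + 1) * f (D / x) = (D - l * x) * (x ^ CARD('k) * det (U (D / x) 1))"
    by (simp add: mult.assoc mult.left_commute)
  also have "\<dots> = (D / l - x) * det (U x 1)"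
    using l by (simp add: 1[symmetric] 4 field_simps)
  finally show "(x - l) * (x ^ (CARD('k) + 1) * f (D / x)) = (D / l - x) * f x"
    by (simp add: fU)
qed

lemma integral_conformal_matrix_trivial:
  fixes T P :: "real^(unit + 'k::finite)^(unit + 'k)" and M :: "int^(unit + 'k)^(unit + 'k)"
  assumes TT: "transpose T ** T = (\<chi> i j. if i = j then (case i of Inl _ \<Rightarrow> l\<^sup>2 | Inr _ \<Rightarrow> D) else 0)"
    "T ** transpose T = (\<chi> i j. if i = j then (case i of Inl _ \<Rightarrow> l\<^sup>2 | Inr _ \<Rightarrow> D) else 0)"
    and T0: "T $ Inl () $ Inl () = l" "\<And>b. T $ Inl () $ Inr b = 0" "\<And>b. T $ Inr b $ Inl () = 0"
    and D: "D > 0" and n: "CARD('k) = 2 * n" "n \<ge> 2" and l: "l = (1 / D) ^ n" and det1: "det T = 1"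
    and P: "det P \<noteq> 0" and TP: "T ** P = P ** (\<chi> i j. of_int (M $ i $ j))"
  shows "D = 1"
proof (rule integer_reciprocal_polynomial_trivial)
  note ch = poly_int_charpoly_similar[OF P TP]
  have l0: "l > 0" using D l by simp
  note fe = charpoly_functional_equation[OF TT(2) T0 l0 D _ det1]
  show "n \<ge> 2" "D > 0" by fact+
  show "degree (int_charpoly M) = 2 * n + 1" "coeff (int_charpoly M) (2 * n + 1) = 1"
    using int_charpoly_monic[of M] n by simp_all
  \<comment> \<open>The dimension 2n + 1 is odd, so the constant coefficient is minus the
    determinant of \<open>T\<close>.\<close>
  have "poly (map_poly real_of_int (int_charpoly M)) 0 = det (- T)"
    unfolding ch by (rule arg_cong[where f=det]) (simp add: vec_eq_iff)
  also have "\<dots> = (- 1) ^ CARD(unit + 'k) * det T"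
  proof -
    have "- T = mat (- 1) ** T"
      by (simp add: vec_eq_iff matrix_matrix_mult_def mat_def if_distrib[where f="\<lambda>x. x * _"] cong: if_cong)
    moreover have "det (mat (- 1) :: real^(unit + 'k)^(unit + 'k)) = (- 1) ^ CARD(unit + 'k)"
      by (subst det_diagonal) (auto simp: mat_def)
    ultimately show ?thesis by (metis det_mul)
  qed
  also have "\<dots> = -1" using n det1 by simp
  finally show "coeff (int_charpoly M) 0 = -1"
    by (simp add: poly_0_coeff_0 coeff_map_poly)
  show "poly (map_poly of_int (int_charpoly M)) ((1 / D) ^ n) = 0"
    unfolding ch l[symmetric] using fe(2)[OF _ one_neq_zero] n by simp
  show "norm z = (1 / D) ^ n \<or> norm z = sqrt D" if "poly (map_poly of_int (int_charpoly M)) z = 0" for z :: complex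
    using eigenvalue_modulus[OF TT(1) T0(1,2) l0 D, of z] that unfolding ch l by simp
  show "(x - (1 / D) ^ n) * (x ^ (2 * n + 1) * poly (map_poly of_int (int_charpoly M)) (D / x)) =
      (D ^ (n + 1) - x) * poly (map_poly of_int (int_charpoly M)) x" if "x \<noteq> 0" for x
  proof -
    have "D / l = D ^ (n + 1)" using D by (simp add: l power_divide)
    then show ?thesis using fe(1)[OF _ that] n unfolding ch by (simp add: l[symmetric])
  qed
qed

section \<open>Non-existence of lattices\<close>

text \<open>Block-diagonality holds for all powers and passes to the series entry by entry.\<close>

lemma mexp_adf1_block:
  fixes B :: "real^('n::finite + 'n)^('n + 'n)"
  shows "mexp (t *\<^sub>R adf1 \<mu> B) $ Inl () $ Inl () = exp (t * \<mu>)"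
    "mexp (t *\<^sub>R adf1 \<mu> B) $ Inl () $ Inr b = 0" "mexp (t *\<^sub>R adf1 \<mu> B) $ Inr b $ Inl () = 0"
proof -
  let ?X = "t *\<^sub>R adf1 \<mu> B"
  have P: "mpow ?X k $ Inl () $ Inl () = (t * \<mu>) ^ k \<and> mpow ?X k $ Inl () $ Inr b = 0 \<and>
      (\<forall>b. mpow ?X k $ Inr b $ Inl () = 0)" for k
    by (induction k) (auto simp: mat_def matrix_matrix_mult_def sum_UNIV_Plus UNIV_unit adf1_def)
  note s = mexp_entry_sums[of ?X]
  show "mexp ?X $ Inl () $ Inl () = exp (t * \<mu>)"
    using s[of "Inl ()" "Inl ()"] exp_converges[of "t * \<mu>"]
    by (simp add: P divide_inverse mult.commute sums_unique2)
  show "mexp ?X $ Inl () $ Inr b = 0" "mexp ?X $ Inr b $ Inl () = 0"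
    using s[of "Inl ()" "Inr b"] s[of "Inr b" "Inl ()"] by (simp_all add: P sums_unique2[OF _ sums_zero])
qed

text \<open>In the sum of \<open>adf1\<close> and its transpose the skew matrix \<open>B\<close>
  cancels. What remains is scalar on each block, so it commutes with \<open>adf1\<close>; hence
  \<open>adf1\<close> is normal and the exponentials multiply.\<close>

lemma mexp_adf1_conformal:
  fixes B :: "real^('n::finite + 'n)^('n + 'n)" and t \<mu> :: real
  defines "T \<equiv> mexp (t *\<^sub>R adf1 \<mu> B)"
  defines "\<Delta> \<equiv> \<chi> i j. if i = j then (case i of Inl _ \<Rightarrow> (exp (t * \<mu>))\<^sup>2 | Inr _ \<Rightarrow> exp (- (t * \<mu> / CARD('n)))) else 0"
  assumes B: "transpose B = - B"
  shows "transpose T ** T = \<Delta>" "T ** transpose T = \<Delta>"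
proof -
  let ?A = "adf1 \<mu> B"
  define d where "d i = (case i of Inl _ \<Rightarrow> 2 * \<mu> | Inr _ \<Rightarrow> - (\<mu> / CARD('n)))" for i :: "unit + ('n + 'n)"
  define Dg :: "real^(unit + ('n + 'n))^(unit + ('n + 'n))" where "Dg = (\<chi> i j. if i = j then d i else 0)"
  have Bs: "B $ a $ b = - B $ b $ a" for a b
    using arg_cong[OF B, of "\<lambda>X. X $ b $ a"] by (simp add: transpose_def)
  have tA: "transpose ?A = Dg - ?A"
  proof -
    have "transpose ?A $ i $ j = (Dg - ?A) $ i $ j" for i j
    proof (cases i; cases j)
      fix a b assume "i = Inr a" "j = Inr b"
      then show ?thesis using Bs[of a b] by (auto simp: transpose_def adf1_def Dg_def d_def)
    qed (auto simp: transpose_def adf1_def Dg_def d_def)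
    then show ?thesis by (simp add: vec_eq_iff)
  qed
  have comm: "Dg ** ?A = ?A ** Dg"
  proof -
    have "(Dg ** ?A) $ i $ j = d i * ?A $ i $ j" "(?A ** Dg) $ i $ j = ?A $ i $ j * d j" for i j
      by (simp_all add: Dg_def matrix_matrix_mult_def if_distrib[where f="\<lambda>x. x * _"] if_distrib[where f="\<lambda>x. _ * x"] cong: if_cong)
    moreover have "d i * ?A $ i $ j = ?A $ i $ j * d j" for i j
      by (auto simp: adf1_def d_def split: sum.splits)
    ultimately show ?thesis by (simp add: vec_eq_iff)
  qed
  have comm': "transpose ?A ** ?A = ?A ** transpose ?A"
    unfolding tA by (simp add: matrix_mul_diff comm)
  have tT: "transpose T = mexp (t *\<^sub>R transpose ?A)"
    unfolding T_def mexp_transpose[symmetric] by (rule arg_cong[where f=mexp]) (simp add: vec_eq_iff transpose_def)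
  have sum: "t *\<^sub>R transpose ?A + t *\<^sub>R ?A = (\<chi> i j. if i = j then t * d i else 0)"
    unfolding tA by (simp add: vec_eq_iff Dg_def algebra_simps)
  have "mexp (t *\<^sub>R transpose ?A + t *\<^sub>R ?A) = \<Delta>"
    unfolding sum mexp_diagonal \<Delta>_def
    by (auto simp: vec_eq_iff d_def power2_eq_square simp flip: exp_add split: sum.splits)
  then show "transpose T ** T = \<Delta>" "T ** transpose T = \<Delta>"
    unfolding tT by (simp_all add: T_def mexp_add[symmetric] matrix_mul_scaleR comm' add.commute)
qed

text \<open>The conformal identity gives the square of the determinant as 1; the sign is positive
  because the exponential is the square of the one at half time.\<close>

lemma det_mexp_adf1:
  fixes B :: "real^('n::finite + 'n)^('n + 'n)"
  assumes B: "transpose B = - B"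
  shows "det (mexp (t *\<^sub>R adf1 \<mu> B)) = 1"
proof -
  let ?E = "\<lambda>t. mexp (t *\<^sub>R adf1 \<mu> B)"
  have "det (?E t) = (det (?E (t / 2)))\<^sup>2"
    using mexp_line_add[of "t / 2" "t / 2" "adf1 \<mu> B"] by (simp add: det_mul power2_eq_square)
  then have pos: "det (?E t) \<ge> 0" by simp
  have "(det (?E t))\<^sup>2 = det (transpose (?E t) ** ?E t)" by (simp add: det_mul power2_eq_square)
  also have "\<dots> = (exp (t * \<mu>))\<^sup>2 * exp (- (t * \<mu> / CARD('n))) ^ CARD('n + 'n)"
    unfolding mexp_adf1_conformal(1)[OF B]
    by (subst det_diagonal) (auto simp: prod_UNIV_Plus UNIV_unit power_add)
  also have "\<dots> = 1"
    by (simp add: exp_of_nat_mult[symmetric] exp_add[symmetric])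
  finally show ?thesis using pos by (simp add: power2_eq_1_iff)
qed

theorem theorem3p7:
  fixes \<mu> :: real and B :: "real^('n::finite + 'n)^('n + 'n)"
  assumes "CARD('n) \<ge> 2" and "\<mu> \<noteq> 0" and "in_u B"
  shows "\<not> (\<exists>\<Gamma> :: (real \<times> (real^(unit + ('n + 'n)))) set. is_lattice (adf1 \<mu> B) \<Gamma>)"
proof
  assume "\<exists>\<Gamma> :: (real \<times> (real^(unit + ('n + 'n)))) set. is_lattice (adf1 \<mu> B) \<Gamma>"
  then obtain \<Gamma> :: "(real \<times> (real^(unit + ('n + 'n)))) set" where lat: "is_lattice (adf1 \<mu> B) \<Gamma>" by blast
  have B: "transpose B = - B" using assms(3) by (simp add: in_u_def)
  let ?E = "\<lambda>t. mexp (t *\<^sub>R adf1 \<mu> B)"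
  have nz: "exp (- (t * \<mu> / CARD('n))) \<noteq> 1" if "t \<noteq> 0" for t using that assms(1,2) by simp
  \<comment> \<open>Otherwise 1 would be an eigenvalue, but neither \<open>exp (t * \<mu>)\<close>
    nor the modulus on the second block equals 1.\<close>
  have "det (mat 1 - ?E t) \<noteq> 0" if t: "t \<noteq> 0" for t
  proof
    assume "det (mat 1 - ?E t) = 0"
    then have "complex_of_real (det (mat 1 - ?E t)) = 0" by simp
    also have "complex_of_real (det (mat 1 - ?E t)) = det (\<chi> i j. complex_of_real ((mat 1 - ?E t) $ i $ j))"
      by (rule det_ring_hom) auto
    also have "\<dots> = det (\<chi> i j. (if i = j then 1 else 0) - complex_of_real (?E t $ i $ j))"
      by (rule arg_cong[where f=det]) (simp add: vec_eq_iff mat_def)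
    finally have "norm (1::complex) = exp (t * \<mu>) \<or> norm (1::complex) = sqrt (exp (- (t * \<mu> / CARD('n))))"
      by (intro eigenvalue_modulus[OF mexp_adf1_conformal(1)[OF B] mexp_adf1_block(1,2)]) auto
    then show False using nz[OF t] t assms(2) by auto
  qed
  then obtain t e L where t: "t \<noteq> 0" and L: "0 \<in> L" "\<And>x y. x \<in> L \<Longrightarrow> y \<in> L \<Longrightarrow> x - y \<in> L"
    "e > 0" "\<And>x. x \<in> L \<Longrightarrow> norm x < e \<Longrightarrow> x = 0" "span L = UNIV" "\<And>x. x \<in> L \<Longrightarrow> ?E t *v x \<in> L"
    using lattice_meets_ideal[OF lat] by metis
  obtain P M where P: "det P \<noteq> 0" "?E t ** P = P ** (\<chi> i j. of_int (M $ i $ j))"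
    using lattice_automorphism_integral[OF L] by blast
  \<comment> \<open>With D = exp(-t \<mu> / n) the first eigenvalue is D^(-n), the form required for
    the arithmetic argument.\<close>
  have l: "exp (t * \<mu>) = (1 / exp (- (t * \<mu> / CARD('n)))) ^ CARD('n)"
    by (simp add: exp_minus exp_of_nat_mult[symmetric] field_simps)
  have "exp (- (t * \<mu> / CARD('n))) = 1"
    by (rule integral_conformal_matrix_trivial[OF mexp_adf1_conformal[OF B] mexp_adf1_block _ _ assms(1) l det_mexp_adf1[OF B] P]) auto
  with nz[OF t] show False by simp
qed

end
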